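(* Assume that for all integers $n\ge 1$ and $0\le k\le n-1$ one has \[\langle \Delta'_{e_{n-k-1}}e_n,h_1^n\rangle=\sum_{P\in\mathsf{stLD}(n)^{\bullet k}}q^{\mathsf{dinv}(P)}t^{\mathsf{area}(P)}.\] Then for all integers $n\ge 1$, \[\sum_{k=0}^{n-1}\left.\langle \Delta'_{e_{n-k-1}}e_n,h_1^n\rangle\right|_{q=-1}z^k=\sum_{\sigma\in\mathfrak S_n}t^{\mathsf{inv}_3(\sigma)}z^{\mathsf{monot}(\sigma)}.\]
   Context: Symmetric functions. $\Lambda$ is the algebra of symmetric functions over $\mathbb Q(q,t)$ with the Hall scalar product $\langle\,,\rangle$ (Schur functions are orthonormal); $e_n$, $h_n$ are the elementary and complete homogeneous symmetric functions. For a partition $\mu\vdash n$, $\tilde H_\mu=\tilde H_\mu[X;q,t]=\sum_{\lambda\vdash n}K_{\lambda\mu}(q,1/t)\,t^{n(\mu)}s_\lambda$ is the modified Macdonald polynomial, where $K_{\lambda\mu}(q,t)$ are the Macdonald $q,t$-Kostka coefficients and $n(\mu)=\sum_i(i-1)\mu_i$; equivalently, $\tilde H_\mu$ is characterised by $\tilde H_\mu[X(1-q)]\in\mathrm{span}\{s_\lambda:\lambda\ge\mu\}$, $\tilde H_\mu[X(1-t)]\in\mathrm{span}\{s_\lambda:\lambda\ge\mu'\}$ (dominance order, plethystic notation $p_r[X(1-u)]=(1-u^r)p_r$) and $\langle\tilde H_\mu,s_{(n)}\rangle=1$. The $\tilde H_\mu$ form a basis of $\Lambda$. With the cells of $\mu$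 being $(i,j)$, $1\le i\le\mu_j$, $1\le j\le\ell(\mu)$, put $B_\mu=\sum_{(i,j)\in\mu}q^{i-1}t^{j-1}$. For $f\in\Lambda$, the linear operator $\Delta'_f$ on $\Lambda$ is defined by $\Delta'_f\tilde H_\mu=f[B_\mu-1]\tilde H_\mu$ (plethystic evaluation, i.e. $f$ evaluated at the monomials $q^{i-1}t^{j-1}$, $(i,j)\in\mu$, $(i,j)\neq(1,1)$). Dyck paths. A Dyck path of size $n$ is a lattice path from $(0,0)$ to $(n,n)$ with unit north and east steps staying weakly above the line $x=y$. A standardly labelled Dyck path is a pair $(\pi,w)$ with $\pi$ a Dyck path of size $n$ and $w=w_1\cdots w_n$ a permutation of $\{1,\dots,n\}$, where $w_i$ labels the $i$-th vertical (north) step of $\pi$, such that the labels of vertical steps lying in the same column are increasing from bottom to top. The area word $a=a_1\cdots a_n$ of $\pi$: $a_i$ is the number of whole unit squares between the $i$-th vertical step and the line $x=y$. The $i$-th vertical step ($2\le i\le n$) is a contractible valley of $(\pi,w)$ if either $a_{i-1}>a_i$, or $a_{i-1}=a_i$ and $w_{i-1}<w_i$. The set $\mathsf{stLD}(n)^{\bullet k}$ consists of the triples $P=(\pi,w,dv)$ with $(\pi,w)$ a standardly labelled Dyck path of size $n$ and $dv$ a $k$-element subset of (the indices of) its contractible valleys. $\mathsf{area}(P)=\sum_i a_i$. A pair $(i,j)$ with $1\le i<j\le n$ is a primary diagonal inversion if $a_i=a_j$, $w_i<w_j$ and $i\notin dv$; a secondary diagonal inversion if $a_i=a_j+1$, $w_i>w_j$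 and $i\notin dv$. $\mathsf{dinv}(P)$ is the total number of primary and secondary diagonal inversions minus $|dv|$. Statistics on permutations. For $\sigma\in\mathfrak S_n$ put $\sigma_0=0$. For $i\in\{2,\dots,n\}$, $\sigma_i$ is a double ascent if $\sigma_{i-2}<\sigma_{i-1}<\sigma_i$; a double descent if $\sigma_{i-2}>\sigma_{i-1}>\sigma_i$; a peak if $\sigma_{i-2}<\sigma_{i-1}>\sigma_i$; a valley if $\sigma_{i-2}>\sigma_{i-1}<\sigma_i$. $\mathsf{monot}(\sigma)$ is the number of $i\in\{2,\dots,n\}$ such that $\sigma_i$ is a double ascent or a double descent. A pair $(i,j)$ with $1\le i<j\le n$ is a $3$-inversion of $\sigma$ if one of the following holds: $\sigma_j$ is a double ascent and $\sigma_{j-1}<\sigma_i<\sigma_j$; $\sigma_j$ is a double descent and $\sigma_{j-1}>\sigma_i>\sigma_j$; $\sigma_j$ is a peak and $\sigma_i>\sigma_j$; $\sigma_j$ is a valley and $\sigma_i<\sigma_j$. $\mathsf{inv}_3(\sigma)$ is the number of $3$-inversions of $\sigma$. *)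

theory Defs
  imports
    "HOL-Library.Multiset"
    "HOL-Library.FuncSet"
    "HOL-Combinatorics.Permutations"
    "HOL-Computational_Algebra.Polynomial"
    "HOL-Computational_Algebra.Fraction_Field"
begin

section \<open>Symmetric functions\<close>

text \<open>A multiset \<open>m\<close> of natural numbers stands for the monomial \<open>\<Prod>i\<in>#m. x\<^sub>i\<close> in the variables
  \<open>x\<^sub>0, x\<^sub>1, \<dots>\<close>, and a formal series for its function of coefficients. Symmetric functions are the
  series of bounded degree that are invariant under permutations of the variables.\<close>

typedef (overloaded) 'a symf =
  "{f :: nat multiset \<Rightarrow> 'a::zero.
      (\<exists>d. \<forall>m. f m \<noteq> 0 \<longrightarrow> size m \<le> d) \<and>
      (\<forall>\<pi> m. bij \<pi> \<longrightarrow> f (image_mset \<pi> m) = f m)}"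
  morphisms coeff_symf Abs_symf
  by (rule exI[of _ "\<lambda>_. 0"]) auto

setup_lifting type_definition_symf

lemma finite_submultisets: "finite {a. a \<subseteq># (m :: 'b multiset)}"
proof (induction m)
  case (add x m)
  have "{a. a \<subseteq># add_mset x m} \<subseteq> {a. a \<subseteq># m} \<union> add_mset x ` {a. a \<subseteq># m}"
  proof
    fix a assume a: "a \<in> {a. a \<subseteq># add_mset x m}"
    show "a \<in> {a. a \<subseteq># m} \<union> add_mset x ` {a. a \<subseteq># m}"
    proof (cases "x \<in># a")
      case True
      then obtain b where "a = add_mset x b" by (metis insert_DiffM)
      with a show ?thesis by auto
    next
      case False
      with a have "a \<subseteq># m"
        by (metis mem_Collect_eq diff_single_trivial subset_eq_diff_conv
            add_mset_add_single)
      then show ?thesis by simp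
    qed
  qed
  with add show ?case by (meson finite_UnI finite_imageI finite_subset)
qed simp

lemma image_mset_inv_bij: "bij \<pi> \<Longrightarrow> image_mset (inv \<pi>) (image_mset \<pi> m) = m"
  by (simp add: multiset.map_comp bij_is_inj)

lemma count_image_mset_bij: "bij \<pi> \<Longrightarrow> count (image_mset \<pi> m) (\<pi> i) = count m i"
  by (induction m) (auto dest: bij_is_inj injD)

lemma submultisets_image_bij:
  assumes "bij \<pi>"
  shows "{a. a \<subseteq># image_mset \<pi> m} = image_mset \<pi> ` {a. a \<subseteq># m}"
proof (intro equalityI subsetI)
  fix a assume "a \<in> {a. a \<subseteq># image_mset \<pi> m}"
  then have "image_mset (inv \<pi>) a \<subseteq># m"
    by (metis mem_Collect_eq image_mset_subseteq_mono image_mset_inv_bij[OF assms])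
  moreover have "a = image_mset \<pi> (image_mset (inv \<pi>) a)"
    using image_mset_inv_bij[OF bij_imp_bij_inv[OF assms], of a] by (simp add: assms inv_inv_eq)
  ultimately show "a \<in> image_mset \<pi> ` {a. a \<subseteq># m}" by blast
qed (auto intro: image_mset_subseteq_mono)

instantiation symf :: (comm_ring_1) comm_ring_1
begin

lift_definition zero_symf :: "'a symf" is "\<lambda>_. 0" by auto

lift_definition one_symf :: "'a symf" is "\<lambda>m. if m = {#} then 1 else 0" by auto

lift_definition uminus_symf :: "'a symf \<Rightarrow> 'a symf" is "\<lambda>f m. - f m" by auto

lift_definition plus_symf :: "'a symf \<Rightarrow> 'a symf \<Rightarrow> 'a symf" is "\<lambda>f g m. f m + g m"
proof (elim conjE exE, intro conjI)
  fix f g :: "nat multiset \<Rightarrow> 'a" and d d'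
  assume "\<forall>m. f m \<noteq> 0 \<longrightarrow> size m \<le> d" "\<forall>m. g m \<noteq> 0 \<longrightarrow> size m \<le> d'"
  then have "\<forall>m. f m + g m \<noteq> 0 \<longrightarrow> size m \<le> max d d'"
    by (metis add.left_neutral add.right_neutral le_max_iff_disj)
  then show "\<exists>d. \<forall>m. f m + g m \<noteq> 0 \<longrightarrow> size m \<le> d" by blast
qed simp

definition minus_symf :: "'a symf \<Rightarrow> 'a symf \<Rightarrow> 'a symf" where "minus_symf f g = f + - g"

lift_definition times_symf :: "'a symf \<Rightarrow> 'a symf \<Rightarrow> 'a symf"
  is "\<lambda>f g m. \<Sum>a | a \<subseteq># m. f a * g (m - a)"
proof (elim conjE exE, intro conjI allI impI)
  fix f g :: "nat multiset \<Rightarrow> 'a" and d d'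
  assume d: "\<forall>m. f m \<noteq> 0 \<longrightarrow> size m \<le> d" "\<forall>m. g m \<noteq> 0 \<longrightarrow> size m \<le> d'"
  show "\<exists>d. \<forall>m. (\<Sum>a | a \<subseteq># m. f a * g (m - a)) \<noteq> 0 \<longrightarrow> size m \<le> d"
  proof (intro exI[of _ "d + d'"] allI impI)
    fix m :: "nat multiset" assume "(\<Sum>a | a \<subseteq># m. f a * g (m - a)) \<noteq> 0"
    then obtain a where a: "a \<subseteq># m" "f a * g (m - a) \<noteq> 0"
      by (metis (mono_tags, lifting) mem_Collect_eq sum.neutral)
    then have "f a \<noteq> 0" "g (m - a) \<noteq> 0" by auto
    then have "size a \<le> d" "size (m - a) \<le> d'" using d by auto
    with a(1) show "size m \<le> d + d'" by (simp add: size_Diff_submset)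
  qed
next
  fix f g :: "nat multiset \<Rightarrow> 'a" and \<pi> :: "nat \<Rightarrow> nat" and m
  assume f: "\<forall>\<pi> m. bij \<pi> \<longrightarrow> f (image_mset \<pi> m) = f m"
    and g: "\<forall>\<pi> m. bij \<pi> \<longrightarrow> g (image_mset \<pi> m) = g m" and \<pi>: "bij \<pi>"
  have "inj_on (image_mset \<pi>) {a. a \<subseteq># m}"
    by (metis inj_on_inverseI image_mset_inv_bij[OF \<pi>])
  then have "(\<Sum>a | a \<subseteq># image_mset \<pi> m. f a * g (image_mset \<pi> m - a)) =
      (\<Sum>a | a \<subseteq># m. f (image_mset \<pi> a) * g (image_mset \<pi> m - image_mset \<pi> a))"
    unfolding submultisets_image_bij[OF \<pi>] by (simp add: sum.reindex)
  also have "\<dots> = (\<Sum>a | a \<subseteq># m. f a * g (m - a))"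
    using f g \<pi> by (intro sum.cong) (auto simp flip: image_mset_Diff)
  finally show "(\<Sum>a | a \<subseteq># image_mset \<pi> m. f a * g (image_mset \<pi> m - a)) =
      (\<Sum>a | a \<subseteq># m. f a * g (m - a))" .
qed

instance
proof
  fix f g h :: "'a symf"
  show "f * g * h = f * (g * h)"
  proof (transfer, rule ext)
    fix f g h :: "nat multiset \<Rightarrow> 'a" and m
    have "(\<Sum>a | a \<subseteq># m. (\<Sum>b | b \<subseteq># a. f b * g (a - b)) * h (m - a)) =
        (\<Sum>(a, b)\<in>(SIGMA a:{a. a \<subseteq># m}. {b. b \<subseteq># a}). f b * g (a - b) * h (m - a))"
      by (simp add: sum_distrib_right sum.Sigma finite_submultisets)
    also have "\<dots> = (\<Sum>(b, c)\<in>(SIGMA b:{b. b \<subseteq># m}. {c. c \<subseteq># m - b}).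
        f b * (g c * h (m - b - c)))"
      by (rule sum.reindex_bij_witness[of _ "\<lambda>(b, c). (b + c, b)" "\<lambda>(a, b). (b, a - b)"])
        (auto simp: subset_mset.le_diff_conv2 subset_mset.add_increasing2 mult.assoc
          subset_mset.diff_add add.commute subset_eq_diff_conv
          intro: subset_mset.order_trans subset_mset.add_decreasing2)
    also have "\<dots> = (\<Sum>a | a \<subseteq># m. f a * (\<Sum>c | c \<subseteq># m - a. g c * h (m - a - c)))"
      by (simp add: sum_distrib_left sum.Sigma finite_submultisets)
    finally show "(\<Sum>a | a \<subseteq># m. (\<Sum>b | b \<subseteq># a. f b * g (a - b)) * h (m - a)) =
        (\<Sum>a | a \<subseteq># m. f a * (\<Sum>c | c \<subseteq># m - a. g c * h (m - a - c)))" .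
  qed
  show "f * g = g * f"
  proof (transfer, rule ext)
    fix f g :: "nat multiset \<Rightarrow> 'a" and m
    show "(\<Sum>a | a \<subseteq># m. f a * g (m - a)) = (\<Sum>a | a \<subseteq># m. g a * f (m - a))"
      by (rule sum.reindex_bij_witness[of _ "\<lambda>a. m - a" "\<lambda>a. m - a"])
        (auto simp: subset_mset.diff_diff_right mult.commute)
  qed
  show "1 * f = f"
  proof (transfer, rule ext)
    fix f :: "nat multiset \<Rightarrow> 'a" and m
    have "(\<Sum>a | a \<subseteq># m. (if a = {#} then 1 else 0) * f (m - a)) =
        (\<Sum>a\<in>{{#}}. (if a = {#} then 1 else 0) * f (m - a))"
      by (rule sum.mono_neutral_right) (auto simp: finite_submultisets)
    then show "(\<Sum>a | a \<subseteq># m. (if a = {#} then 1 else 0) * f (m - a)) = f m" by simp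
  qed
  show "(f + g) * h = f * h + g * h"
    by transfer (auto simp: distrib_right sum.distrib)
  show "f + g + h = f + (g + h)" by transfer (simp add: add.assoc)
  show "f + g = g + f" by transfer (simp add: add.commute)
  show "0 + f = f" by transfer simp
  show "- f + f = 0" by transfer simp
  show "f - g = f + - g" by (simp add: minus_symf_def)
  show "(0 :: 'a symf) \<noteq> 1" by transfer (metis one_neq_zero)
qed

end

lift_definition scale :: "'a::comm_ring_1 \<Rightarrow> 'a symf \<Rightarrow> 'a symf" is "\<lambda>c f m. c * f m"
  by (metis mult_zero_right)

interpretation symf: vector_space "scale :: 'a::field \<Rightarrow> 'a symf \<Rightarrow> 'a symf"
  by unfold_locales (transfer; simp add: algebra_simps)+

lift_definition elementary :: "nat \<Rightarrow> 'a::comm_ring_1 symf"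
  is "\<lambda>n m. if size m = n \<and> (\<forall>i. count m i \<le> 1) then 1 else 0"
proof (intro conjI allI impI)
  fix n m and \<pi> :: "nat \<Rightarrow> nat" assume \<pi>: "bij \<pi>"
  then have "(\<forall>i. count (image_mset \<pi> m) i \<le> 1) \<longleftrightarrow> (\<forall>i. count m i \<le> 1)"
    by (metis bij_pointE count_image_mset_bij)
  then show "(if size (image_mset \<pi> m) = n \<and> (\<forall>i. count (image_mset \<pi> m) i \<le> 1) then 1 else 0) =
      (if size m = n \<and> (\<forall>i. count m i \<le> 1) then 1 else (0 :: 'a))" by simp
qed auto

lift_definition homogeneous :: "nat \<Rightarrow> 'a::comm_ring_1 symf"
  is "\<lambda>n m. if size m = n then 1 else 0"
  by auto

text \<open>The power sums are meant for \<open>r \<ge> 1\<close>.\<close>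

lift_definition powersum :: "nat \<Rightarrow> 'a::comm_ring_1 symf"
  is "\<lambda>r m. if \<exists>i. m = replicate_mset r i then 1 else 0"
proof (intro conjI allI impI)
  fix r m and \<pi> :: "nat \<Rightarrow> nat" assume \<pi>: "bij \<pi>"
  have "(\<exists>i. image_mset \<pi> m = replicate_mset r i) \<longleftrightarrow> (\<exists>i. m = replicate_mset r i)"
    by (metis image_replicate_mset image_mset_inv_bij[OF \<pi>])
  then show "(if \<exists>i. image_mset \<pi> m = replicate_mset r i then 1 else 0) =
      (if \<exists>i. m = replicate_mset r i then 1 else (0 :: 'a))" by simp
qed auto

text \<open>The value of \<open>f\<close> at \<open>x\<^sub>i = xs ! i\<close> for \<open>i < length xs\<close> and \<open>x\<^sub>i = 0\<close> for all other \<open>i\<close>;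
  the sum is finite since \<open>f\<close> has bounded degree.\<close>

definition eval_symf :: "'a::comm_ring_1 symf \<Rightarrow> 'a list \<Rightarrow> 'a" where
  "eval_symf f xs =
    (\<Sum>m | set_mset m \<subseteq> {..<length xs} \<and> coeff_symf f m \<noteq> 0. coeff_symf f m * (\<Prod>i\<in>#m. xs ! i))"


section \<open>Partitions and Schur functions\<close>

definition is_partition :: "nat list \<Rightarrow> bool" where
  "is_partition \<mu> \<longleftrightarrow> sorted_wrt (\<ge>) \<mu> \<and> 0 \<notin> set \<mu>"

definition conjugate :: "nat list \<Rightarrow> nat list" where
  "conjugate \<mu> = map (\<lambda>i. card {j. j < length \<mu> \<and> i < \<mu> ! j}) [0..<foldr max \<mu> 0]"

definition dominates :: "nat list \<Rightarrow> nat list \<Rightarrow> bool" where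
  "dominates \<nu> \<mu> \<longleftrightarrow>
    sum_list \<nu> = sum_list \<mu> \<and> (\<forall>k. sum_list (take k \<mu>) \<le> sum_list (take k \<nu>))"

text \<open>Rows are the second coordinate, as in \<open>1 \<le> i \<le> \<mu>\<^sub>j\<close>, but both coordinates start at 0.\<close>

definition cells :: "nat list \<Rightarrow> (nat \<times> nat) set" where
  "cells \<mu> = {(i, j). j < length \<mu> \<and> i < \<mu> ! j}"

definition ssyt :: "nat list \<Rightarrow> (nat \<times> nat \<Rightarrow> nat) set" where
  "ssyt \<nu> = {T \<in> extensional (cells \<nu>).
    (\<forall>i i' j. i < i' \<and> (i', j) \<in> cells \<nu> \<longrightarrow> T (i, j) \<le> T (i', j)) \<and>
    (\<forall>i j j'. j < j' \<and> (i, j') \<in> cells \<nu> \<longrightarrow> T (i, j) < T (i, j'))}"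

text \<open>The generating function of semistandard tableaux. That the numbers of tableaux are symmetric
  in the content (Bender and Knuth), so that \<^term>\<open>Abs_symf\<close> is applied within its domain, is not
  proved here.\<close>

definition schur :: "nat list \<Rightarrow> 'a::comm_ring_1 symf" where
  "schur \<nu> = Abs_symf (\<lambda>m.
    of_nat (card {T \<in> ssyt \<nu>. image_mset T (mset_set (cells \<nu>)) = m}))"


section \<open>Macdonald polynomials and Delta operators\<close>

text \<open>\<open>\<rat>(q,t)\<close> is the field of fractions of \<open>\<rat>[t][q]\<close>, the inner polynomial variable being \<open>t\<close>.\<close>

type_synonym rat_qt = "rat poly poly fract"
type_synonym rat_t = "rat poly fract"

definition q_var :: rat_qt where "q_var = Fract [:0, 1:] 1"

definition t_var :: rat_qt where "t_var = Fract [:[:0, 1:]:] 1"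

text \<open>The definitions by \<open>THE\<close> below pin down objects that exist and are unique: the Schur functions
  and the modified Macdonald polynomials are bases, and the power sums are algebraically independent
  generators.\<close>

definition hall :: "rat_qt symf \<Rightarrow> rat_qt symf \<Rightarrow> rat_qt" where
  "hall = (THE B.
    (\<forall>f. Vector_Spaces.linear scale (*) (B f)) \<and>
    (\<forall>g. Vector_Spaces.linear scale (*) (\<lambda>f. B f g)) \<and>
    (\<forall>\<nu> \<mu>. is_partition \<nu> \<and> is_partition \<mu> \<longrightarrow>
      B (schur \<nu>) (schur \<mu>) = (if \<nu> = \<mu> then 1 else 0)))"

text \<open>The plethysm \<open>f \<mapsto> f[X(1-u)]\<close>, for the algebra over \<open>\<rat>(q,t)\<close>; raising \<open>u\<close> to the power \<open>r\<close> is the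
  plethystic rule for a monomial \<open>u\<close>, and it is used only for \<open>u = q\<close> and \<open>u = t\<close>.\<close>

definition pleth_one_minus :: "rat_qt \<Rightarrow> rat_qt symf \<Rightarrow> rat_qt symf" where
  "pleth_one_minus u = (THE \<phi>.
    Vector_Spaces.linear scale scale \<phi> \<and> \<phi> 1 = 1 \<and> (\<forall>f g. \<phi> (f * g) = \<phi> f * \<phi> g) \<and>
    (\<forall>r\<ge>1. \<phi> (powersum r) = scale (1 - u ^ r) (powersum r)))"

definition macdonald :: "nat list \<Rightarrow> rat_qt symf" where
  "macdonald \<mu> = (THE H.
    pleth_one_minus q_var H \<in> symf.span {schur \<nu> | \<nu>. is_partition \<nu> \<and> dominates \<nu> \<mu>} \<and>
    pleth_one_minus t_var H \<in>
      symf.span {schur \<nu> | \<nu>. is_partition \<nu> \<and> dominates \<nu> (conjugate \<mu>)} \<and>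
    hall H (schur [sum_list \<mu>]) = 1)"

text \<open>The monomials of \<open>B\<^sub>\<mu> - 1\<close>. The order of the list is irrelevant.\<close>

definition B_minus_one :: "nat list \<Rightarrow> rat_qt list" where
  "B_minus_one \<mu> =
    [q_var ^ i * t_var ^ j. j \<leftarrow> [0..<length \<mu>], i \<leftarrow> [0..<\<mu> ! j], (i, j) \<noteq> (0, 0)]"

definition Delta' :: "rat_qt symf \<Rightarrow> rat_qt symf \<Rightarrow> rat_qt symf" where
  "Delta' f = (THE D. Vector_Spaces.linear scale scale D \<and>
    (\<forall>\<mu>. is_partition \<mu> \<longrightarrow> D (macdonald \<mu>) = scale (eval_symf f (B_minus_one \<mu>)) (macdonald \<mu>)))"

text \<open>Specialisation of \<open>q\<close> to a rational number \<open>c\<close>, for rational functions without a pole at \<open>q = c\<close>.\<close>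

definition q_at :: "rat \<Rightarrow> rat_qt \<Rightarrow> rat_t" where
  "q_at c f = (THE v. \<exists>a b. poly b [:c:] \<noteq> 0 \<and> f = Fract a b \<and>
    v = Fract (poly a [:c:]) (poly b [:c:]))"


section \<open>Decorated labelled Dyck paths\<close>

datatype step = North | East

definition dyck_path :: "nat \<Rightarrow> step list \<Rightarrow> bool" where
  "dyck_path n \<pi> \<longleftrightarrow> count_list \<pi> North = n \<and> count_list \<pi> East = n \<and>
    (\<forall>k. count_list (take k \<pi>) East \<le> count_list (take k \<pi>) North)"

text \<open>The \<open>x\<close>-coordinates of the north steps of a path that starts at \<open>x\<close>-coordinate \<open>x\<close>.\<close>

fun north_columns :: "nat \<Rightarrow> step list \<Rightarrow> nat list" where
  "north_columns x [] = []"
| "north_columns x (North # \<pi>) = x # north_columns x \<pi>"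
| "north_columns x (East # \<pi>) = north_columns (x + 1) \<pi>"

text \<open>North steps are numbered from 1, so the \<open>i\<close>-th one starts at height \<open>i - 1\<close>.\<close>

definition column :: "step list \<Rightarrow> nat \<Rightarrow> nat" where
  "column \<pi> i = north_columns 0 \<pi> ! (i - 1)"

definition area_word :: "step list \<Rightarrow> nat \<Rightarrow> nat" where
  "area_word \<pi> i = (i - 1) - column \<pi> i"

definition st_labelling :: "nat \<Rightarrow> step list \<Rightarrow> (nat \<Rightarrow> nat) \<Rightarrow> bool" where
  "st_labelling n \<pi> w \<longleftrightarrow> w permutes {1..n} \<and>
    (\<forall>i j. 1 \<le> i \<and> i < j \<and> j \<le> n \<and> column \<pi> i = column \<pi> j \<longrightarrow> w i < w j)"

definition contractible_valleys :: "nat \<Rightarrow> step list \<Rightarrow> (nat \<Rightarrow> nat) \<Rightarrow> nat set" where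
  "contractible_valleys n \<pi> w = {i \<in> {2..n}.
    area_word \<pi> (i - 1) > area_word \<pi> i \<or>
    area_word \<pi> (i - 1) = area_word \<pi> i \<and> w (i - 1) < w i}"

type_synonym decorated_path = "step list \<times> (nat \<Rightarrow> nat) \<times> nat set"

definition stLD :: "nat \<Rightarrow> nat \<Rightarrow> decorated_path set" where
  "stLD n k = {(\<pi>, w, dv). dyck_path n \<pi> \<and> st_labelling n \<pi> w \<and>
    dv \<subseteq> contractible_valleys n \<pi> w \<and> card dv = k}"

fun area :: "nat \<Rightarrow> decorated_path \<Rightarrow> nat" where
  "area n (\<pi>, w, dv) = (\<Sum>i = 1..n. area_word \<pi> i)"

fun primary_dinv :: "nat \<Rightarrow> decorated_path \<Rightarrow> (nat \<times> nat) set" where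
  "primary_dinv n (\<pi>, w, dv) = {(i, j). 1 \<le> i \<and> i < j \<and> j \<le> n \<and>
    area_word \<pi> i = area_word \<pi> j \<and> w i < w j \<and> i \<notin> dv}"

fun secondary_dinv :: "nat \<Rightarrow> decorated_path \<Rightarrow> (nat \<times> nat) set" where
  "secondary_dinv n (\<pi>, w, dv) = {(i, j). 1 \<le> i \<and> i < j \<and> j \<le> n \<and>
    area_word \<pi> i = area_word \<pi> j + 1 \<and> w i > w j \<and> i \<notin> dv}"

definition dinv :: "nat \<Rightarrow> decorated_path \<Rightarrow> int" where
  "dinv n P = int (card (primary_dinv n P)) + int (card (secondary_dinv n P)) -
    int (card (snd (snd P)))"


section \<open>Statistics on permutations\<close>

text \<open>For \<open>\<sigma> permutes {1..n}\<close> the convention \<open>\<sigma>\<^sub>0 = 0\<close> holds automatically. The indices below are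
  meant to be at least 2.\<close>

definition double_ascent :: "(nat \<Rightarrow> nat) \<Rightarrow> nat \<Rightarrow> bool" where
  "double_ascent \<sigma> i \<longleftrightarrow> \<sigma> (i - 2) < \<sigma> (i - 1) \<and> \<sigma> (i - 1) < \<sigma> i"

definition double_descent :: "(nat \<Rightarrow> nat) \<Rightarrow> nat \<Rightarrow> bool" where
  "double_descent \<sigma> i \<longleftrightarrow> \<sigma> (i - 2) > \<sigma> (i - 1) \<and> \<sigma> (i - 1) > \<sigma> i"

definition peak :: "(nat \<Rightarrow> nat) \<Rightarrow> nat \<Rightarrow> bool" where
  "peak \<sigma> i \<longleftrightarrow> \<sigma> (i - 2) < \<sigma> (i - 1) \<and> \<sigma> (i - 1) > \<sigma> i"

definition valley :: "(nat \<Rightarrow> nat) \<Rightarrow> nat \<Rightarrow> bool" where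
  "valley \<sigma> i \<longleftrightarrow> \<sigma> (i - 2) > \<sigma> (i - 1) \<and> \<sigma> (i - 1) < \<sigma> i"

definition monot :: "nat \<Rightarrow> (nat \<Rightarrow> nat) \<Rightarrow> nat" where
  "monot n \<sigma> = card {i \<in> {2..n}. double_ascent \<sigma> i \<or> double_descent \<sigma> i}"

definition inv3 :: "nat \<Rightarrow> (nat \<Rightarrow> nat) \<Rightarrow> nat" where
  "inv3 n \<sigma> = card {(i, j). 1 \<le> i \<and> i < j \<and> j \<le> n \<and>
    (double_ascent \<sigma> j \<and> \<sigma> (j - 1) < \<sigma> i \<and> \<sigma> i < \<sigma> j \<or>
     double_descent \<sigma> j \<and> \<sigma> (j - 1) > \<sigma> i \<and> \<sigma> i > \<sigma> j \<or>
     peak \<sigma> j \<and> \<sigma> i > \<sigma> j \<or>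
     valley \<sigma> j \<and> \<sigma> i < \<sigma> j)}"

end

theory Submission
  imports Defs
begin

text \<open>By the hypothesis, the left-hand side is a signed generating function of decorated labelled Dyck
  paths. Fix the diagonal and the decoration of every label, and insert the labels into the path one
  at a time: first the undecorated and then the decorated ones, in each group by increasing diagonal
  and, within a diagonal, by decreasing label. The admissible slots of a label change the number of
  diagonal inversions by \<open>0, \<dots>, s - 1\<close>, where the schedule number \<open>s\<close> does not depend on the path
  built so far. At \<open>q = -1\<close> the sum over the slots is \<open>1\<close> if \<open>s\<close> is odd and \<open>0\<close> otherwise, so what
  remains is to count the assignments of diagonals and decorations for which all schedule numbers are
  odd. Cutting such an assignment, read as a word in the order of the labels, at its unique
  undecorated \<open>0\<close> and rotating it yields the same recursion as appending a last value to a permutation.\<close>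

section \<open>Words with odd schedule numbers\<close>

text \<open>Two consequences of oddness drive the recursion. A nonempty word has exactly one
  undecorated letter on diagonal \<open>0\<close>, which provides a canonical place to cut. And a
  raised letter counts on its left what the unraised letter would count on its right, so a segment
  can be carried between the two ends of a word while changing its diagonals by one; the undecorated
  \<open>0\<close> then takes over the duty of the virtual label. Cuts to the right of the
  \<open>0\<close> create a new undecorated \<open>0\<close> and correspond to peaks and valleys;
  cuts to its left create a decorated \<open>0\<close> and correspond to double ascents and double
  descents. The weight of a cut depends on where the \<open>0\<close> stands, so the total weight
  alone satisfies no recursion; the position of the \<open>0\<close> has to be matched with the rank
  of the last value of a permutation. Hence both sides are summed against an arbitrary function of
  the rank. The insertion order is made for induction: deleting the label inserted last leaves a
  valid path and leaves the schedule numbers of all other labels unchanged.\<close>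

text \<open>A word lists the diagonal and the decoration of the labels \<open>1, 2, \<dots>\<close>. The schedule number of a
  letter \<open>x\<close> is the number of undecorated letters to the left of \<open>x\<close> on diagonal \<open>slot x - 1\<close>, plus the
  number of those to the right of \<open>x\<close> on diagonal \<open>slot x\<close>, plus 1 if \<open>slot x = 0\<close>; that 1 stands for a
  virtual label 0 on diagonal \<open>-1\<close>.\<close>

fun slot :: "nat \<times> bool \<Rightarrow> nat" where
  "slot (d, b) = d + of_bool b"

definition below_count :: "(nat \<times> bool) list \<Rightarrow> nat \<Rightarrow> nat" where
  "below_count p k = (if k = 0 then 0 else count_list p (k - 1, False))"

text \<open>In a factor of a longer word, \<open>N k\<close> is what the rest of the word contributes to a letter with
  slot \<open>k\<close>. Contributions from the left and from the right need not be told apart, and this is why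
  rotating a word preserves the condition.\<close>

definition odd_block :: "(nat \<Rightarrow> nat) \<Rightarrow> (nat \<times> bool) list \<Rightarrow> bool" where
  "odd_block N m \<longleftrightarrow> (\<forall>p x s. m = p @ x # s \<longrightarrow>
     odd (N (slot x) + below_count p (slot x) + count_list s (slot x, False)))"

definition odd_word :: "(nat \<times> bool) list \<Rightarrow> bool" where
  "odd_word = odd_block (\<lambda>k. of_bool (k = 0))"

abbreviation raise :: "(nat \<times> bool) list \<Rightarrow> (nat \<times> bool) list" where
  "raise \<equiv> map (apfst Suc)"

lemma below_count_simps [simp]:
  "below_count [] k = 0"
  "below_count (p @ p') k = below_count p k + below_count p' k"
  "below_count p 0 = 0"
  "below_count p (Suc k) = count_list p (k, False)"
  by (auto simp: below_count_def)

lemma below_count_Cons [simp]: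
  "below_count (x # p) k = of_bool (k = Suc (fst x) \<and> \<not> snd x) + below_count p k"
  by (cases x) (auto simp: below_count_def)

lemma count_raise [simp]:
  "count_list (raise m) (Suc k, b) = count_list m (k, b)"
  "count_list (raise m) (0, b) = 0"
  by (induction m) auto

lemma below_count_raise [simp]: "below_count (raise m) (Suc k) = below_count m k"
  by (cases k) auto

lemma odd_blockI:
  assumes "\<And>p x s. m = p @ x # s \<Longrightarrow>
    odd (N (slot x) + below_count p (slot x) + count_list s (slot x, False))"
  shows "odd_block N m"
  using assms unfolding odd_block_def by blast

lemma odd_blockD:
  assumes "odd_block N m" "m = p @ x # s"
  shows "odd (N (slot x) + below_count p (slot x) + count_list s (slot x, False))"
  using assms unfolding odd_block_def by blast

lemma odd_block_Nil [simp]: "odd_block N []"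
  by (simp add: odd_block_def)

text \<open>Letters of \<open>m\<close> have \<open>m'\<close> on their right, letters of
  \<open>m'\<close> have \<open>m\<close> on their left, so each block absorbs the other into its
  external contribution.\<close>

lemma odd_block_append:
  "odd_block N (m @ m') \<longleftrightarrow>
    odd_block (\<lambda>k. N k + count_list m' (k, False)) m \<and>
    odd_block (\<lambda>k. N k + below_count m k) m'"
proof (intro iffI conjI odd_blockI; (elim conjE)?)
  fix p x s assume *: "odd_block N (m @ m')" and "m = p @ x # s"
  then have "m @ m' = p @ x # (s @ m')" by simp
  from odd_blockD[OF * this]
  show "odd (N (slot x) + count_list m' (slot x, False) + below_count p (slot x)
      + count_list s (slot x, False))"
    by (simp add: add_ac)
next
  fix p x s assume *: "odd_block N (m @ m')" and "m' = p @ x # s"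
  then have "m @ m' = (m @ p) @ x # s" by simp
  from odd_blockD[OF * this]
  show "odd (N (slot x) + below_count m (slot x) + below_count p (slot x)
      + count_list s (slot x, False))"
    by (simp add: add_ac)
next
  fix p x s
  assume m: "odd_block (\<lambda>k. N k + count_list m' (k, False)) m"
    and m': "odd_block (\<lambda>k. N k + below_count m k) m'"
  assume "m @ m' = p @ x # s"
  then consider u where "m = p @ x # u" "s = u @ m'" | u where "p = m @ u" "m' = u @ x # s"
    by (auto simp: append_eq_append_conv2) (metis append_Nil Cons_eq_append_conv)
  then show "odd (N (slot x) + below_count p (slot x) + count_list s (slot x, False))"
  proof cases
    case 1
    from odd_blockD[OF m 1(1)] 1(2) show ?thesis by (simp add: add_ac)
  next
    case 2
    from odd_blockD[OF m' 2(2)] 2(1) show ?thesis by (simp add: add_ac)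
  qed
qed

lemma odd_block_single:
  "odd_block N [x] \<longleftrightarrow> odd (N (slot x))"
proof
  assume "odd_block N [x]"
  then show "odd (N (slot x))" by (auto dest: odd_blockD[where p = "[]" and s = "[]"])
next
  assume *: "odd (N (slot x))"
  show "odd_block N [x]"
  proof (rule odd_blockI)
    fix p y s assume "[x] = p @ y # s"
    then have "p = []" "y = x" "s = []" by (cases p; simp)+
    with * show "odd (N (slot y) + below_count p (slot y) + count_list s (slot y, False))" by simp
  qed
qed

lemma odd_block_Cons:
  "odd_block N (x # m) \<longleftrightarrow> odd (N (slot x) + count_list m (slot x, False)) \<and>
    odd_block (\<lambda>k. N k + below_count [x] k) m"
  using odd_block_append[of N "[x]" m] by (simp add: odd_block_single)

text \<open>Only slots that occur in the block are tested. This lets the rotation lemmas alter the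
  contribution at slot \<open>0\<close> for blocks without an undecorated \<open>0\<close>.\<close>

lemma odd_block_cong:
  assumes "\<And>x. x \<in> set m \<Longrightarrow> N (slot x) = N' (slot x)"
  shows "odd_block N m \<longleftrightarrow> odd_block N' m"
  unfolding odd_block_def using assms by fastforce

lemma odd_block_raise: "odd_block N (raise m) \<longleftrightarrow> odd_block (\<lambda>k. N (Suc k)) m"
proof (induction m arbitrary: N)
  case (Cons x m)
  have "odd_block (\<lambda>k. N (Suc k) + below_count (raise [x]) (Suc k)) m \<longleftrightarrow>
      odd_block (\<lambda>k. N (Suc k) + below_count [x] k) m"
    by (simp only: below_count_raise)
  with Cons show ?case by (cases x) (simp add: odd_block_Cons)
qed simp

section \<open>Existence and uniqueness of the undecorated \<open>0\<close>\<close>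

lemma count_list_ge_2E:
  assumes "\<not> count_list m x \<le> 1"
  obtains p u s where "m = p @ x # u @ x # s" "x \<notin> set u"
proof -
  have "x \<in> set m" using assms by (auto simp: count_list_0_iff intro: ccontr)
  then obtain p m' where m: "m = p @ x # m'" "x \<notin> set p" by (meson split_list_first)
  then have "count_list m' x \<noteq> 0" using assms by (simp add: count_list_0_iff)
  then have "x \<in> set m'" by (simp add: count_list_0_iff)
  then obtain u s where "m' = u @ x # s" "x \<notin> set u" by (meson split_list_first)
  with m that show ?thesis by simp
qed

text \<open>Two consecutive copies of \<open>(k, False)\<close> have schedule numbers differing by
  exactly 1: the first counts the second on its right, and no \<open>(k - 1, False)\<close> between
  them changes the left-hand counts. They cannot both be odd.\<close>

lemma odd_block_count_le_1:
  assumes "odd_block N m" and "\<And>j. k = Suc j \<Longrightarrow> (j, False) \<notin> set m"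
  shows "count_list m (k, False) \<le> 1"
proof (rule ccontr)
  assume "\<not> ?thesis"
  then obtain p u s where m: "m = p @ (k, False) # u @ (k, False) # s" and u: "(k, False) \<notin> set u"
    by (rule count_list_ge_2E)
  have "below_count u k = 0"
    using assms(2) by (cases k) (auto simp: m count_list_0_iff)
  moreover have "odd (N k + below_count p k + count_list (u @ (k, False) # s) (k, False))"
    using odd_blockD[OF assms(1) m] by simp
  moreover have "odd (N k + below_count (p @ (k, False) # u) k + count_list s (k, False))"
    using odd_blockD[OF assms(1), of "p @ (k, False) # u" "(k, False)" s] m by simp
  ultimately show False using u by (auto simp: count_list_0_iff)
qed

lemma odd_word_zero_unique: "odd_word w \<Longrightarrow> count_list w (0, False) \<le> 1"
  unfolding odd_word_def by (rule odd_block_count_le_1) auto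

text \<open>On the lowest diagonal with an undecorated letter, the last such letter counts nothing
  on either side. Its schedule number is the virtual 1 if that diagonal is \<open>0\<close>, and 0
  otherwise.\<close>

lemma odd_word_zero_exists:
  assumes "odd_word w" "w \<noteq> []"
  shows "(0, False) \<in> set w"
proof -
  let ?D = "{d. (d, False) \<in> set w}"
  \<comment> \<open>In a word with decorated letters only, the first letter would have schedule
    number 0.\<close>
  have ex: "\<exists>d. d \<in> ?D"
  proof (rule ccontr)
    assume no: "\<not> ?thesis"
    obtain x s where w: "w = x # s" using assms(2) by (cases w) auto
    obtain d where x: "x = (d, True)" using no w by (cases x; cases "snd x") auto
    have "odd (count_list s (Suc d, False))"
      using assms(1) unfolding odd_word_def w x by (simp add: odd_block_Cons)
    moreover have "count_list s (Suc d, False) = 0" using no w by (auto simp: count_list_0_iff)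
    ultimately show False by simp
  qed
  define m where "m = (LEAST d. d \<in> ?D)"
  have m: "m \<in> ?D" unfolding m_def using ex by (rule LeastI_ex)
  have min: "d \<notin> ?D" if "d < m" for d using that not_less_Least unfolding m_def by blast
  obtain p s where w: "w = p @ (m, False) # s" "(m, False) \<notin> set s"
    using split_list_last[of "(m, False)" w] m by blast
  have "odd (of_bool (m = 0) + below_count p m + count_list s (m, False))"
    using odd_blockD[OF assms(1)[unfolded odd_word_def] w(1)] by simp
  moreover have "below_count p m = 0" using min w by (cases m) (auto simp: count_list_0_iff)
  moreover have "count_list s (m, False) = 0" using w by (simp add: count_list_0_iff)
  ultimately have "m = 0" by (cases "m = 0") auto
  then show ?thesis using m by simp
qed

lemma odd_wordE:
  assumes "odd_word w" "w \<noteq> []"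
  obtains p q where "w = p @ (0, False) # q" "(0, False) \<notin> set p" "(0, False) \<notin> set q"
proof -
  obtain p q where w: "w = p @ (0, False) # q" "(0, False) \<notin> set p"
    using odd_word_zero_exists[OF assms] by (meson split_list_first)
  then have "(0, False) \<notin> set q"
    using odd_word_zero_unique[OF assms(1)] by (simp add: count_list_0_iff)
  with w that show ?thesis by blast
qed

section \<open>Rotating a word at its undecorated \<open>0\<close>\<close>

text \<open>To the left of the \<open>0\<close>, both the virtual label and the \<open>0\<close>
  itself contribute to slot 0, hence the factor 2; to its right, the virtual label serves slot 0 and
  the \<open>0\<close> serves slot 1, hence \<open>k \<le> 1\<close>.\<close>

lemma odd_word_split_zero:
  "odd_word (a @ (0, False) # y) \<longleftrightarrow>
    odd_block (\<lambda>k. 2 * of_bool (k = 0) + count_list y (k, False)) a \<and>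
    even (count_list y (0, False)) \<and>
    odd_block (\<lambda>k. of_bool (k \<le> 1) + below_count a k) y"
  (is "_ \<longleftrightarrow> ?A \<and> _ \<and> ?Y")
proof -
  have "odd_word (a @ (0, False) # y) \<longleftrightarrow>
    odd_block (\<lambda>k. of_bool (k = 0) + count_list ((0, False) # y) (k, False)) a \<and>
    odd (of_bool ((0::nat) = 0) + below_count a 0 + count_list y (0, False)) \<and>
    odd_block (\<lambda>k. of_bool (k = 0) + below_count a k + below_count [(0, False)] k) y"
    by (simp only: odd_word_def odd_block_append odd_block_Cons slot.simps of_bool_eq add_0)
  also have "odd_block (\<lambda>k. of_bool (k = 0) + count_list ((0, False) # y) (k, False)) a \<longleftrightarrow> ?A"
    by (rule odd_block_cong) simp
  also have "odd_block (\<lambda>k. of_bool (k = 0) + below_count a k + below_count [(0, False)] k) y \<longleftrightarrow> ?Y"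
    by (rule odd_block_cong) (auto simp: le_Suc_eq)
  finally show ?thesis by simp
qed

lemma slot_pos: "(0, False) \<notin> set m \<Longrightarrow> x \<in> set m \<Longrightarrow> \<exists>k. slot x = Suc k"
  by (cases x; cases "snd x"; cases "fst x") auto

text \<open>Once \<open>z\<close> is in front of \<open>a\<close>, its letters count on their right
  what their raised copies counted on their left, and conversely for \<open>a\<close>. The
  \<open>0\<close> gives the raised letters at slot 1 the same 1 that the virtual label gives
  \<open>z\<close> at slot 0. The values at slot 0 differ for \<open>a\<close>, but \<open>a\<close>
  has no letter there.\<close>

lemma odd_word_rotate:
  assumes "(0, False) \<notin> set a"
  shows "odd_word (a @ (0, False) # raise z) \<longleftrightarrow> odd_word (z @ a)"
proof -
  have "odd_block (\<lambda>k. 2 * of_bool (k = 0) + count_list (raise z) (k, False)) a \<longleftrightarrow>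
      odd_block (\<lambda>k. of_bool (k = 0) + below_count z k) a"
    using slot_pos[OF assms] by (intro odd_block_cong) fastforce
  moreover have "odd_block (\<lambda>k. of_bool (Suc k \<le> 1) + below_count a (Suc k)) z \<longleftrightarrow>
      odd_block (\<lambda>k. of_bool (k = 0) + count_list a (k, False)) z"
    by (rule odd_block_cong) simp
  ultimately show ?thesis
    unfolding odd_word_split_zero odd_block_raise
    by (simp only: odd_word_def odd_block_append count_raise even_zero) blast
qed

text \<open>The decorated \<open>0\<close> has slot 1 and schedule number 1: it counts the
  undecorated \<open>0\<close> on its left, and no letter of \<open>raise z\<close> because
  \<open>z\<close> has no undecorated \<open>0\<close>. No count sees a decorated letter, so its
  removal changes nothing else, and moving \<open>z\<close> disturbs only slot 0 of \<open>a\<close>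
  and \<open>z\<close>, which is empty in both.\<close>

lemma odd_word_decorated:
  assumes "(0, False) \<notin> set a" "(0, False) \<notin> set x" "(0, False) \<notin> set z"
  shows "odd_word (a @ (0, False) # x @ (0, True) # raise z) \<longleftrightarrow> odd_word (z @ a @ (0, False) # x)"
proof -
  have [simp]: "count_list a (0, False) = 0" "count_list x (0, False) = 0" "count_list z (0, False) = 0"
    using assms by (simp_all add: count_list_0_iff)
  have A: "odd_block (\<lambda>k. 2 * of_bool (k = 0) + count_list (x @ (0, True) # raise z) (k, False)) a \<longleftrightarrow>
      odd_block (\<lambda>k. of_bool (k = 0) + below_count z k + count_list ((0, False) # x) (k, False)) a"
    using slot_pos[OF assms(1)] by (intro odd_block_cong) fastforce
  have X: "odd_block (\<lambda>k. of_bool (k \<le> 1) + below_count a k + count_list ((0, True) # raise z) (k, False)) x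
      \<longleftrightarrow> odd_block (\<lambda>k. of_bool (k \<le> 1) + below_count (z @ a) k) x"
    using slot_pos[OF assms(2)] by (intro odd_block_cong) fastforce
  have Z: "odd_block (\<lambda>k. of_bool (Suc k \<le> 1) + below_count a (Suc k) + below_count x (Suc k) + below_count [(0, True)] (Suc k)) z
      \<longleftrightarrow> odd_block (\<lambda>k. of_bool (k = 0) + count_list (a @ x) (k, False)) z"
    by (intro odd_block_cong) auto
  have Z': "odd_block (\<lambda>k. 2 * of_bool (k = 0) + count_list x (k, False) + count_list a (k, False)) z
      \<longleftrightarrow> odd_block (\<lambda>k. of_bool (k = 0) + count_list (a @ x) (k, False)) z"
    using slot_pos[OF assms(3)] by (intro odd_block_cong) fastforce
  have A': "odd_block (\<lambda>k. 2 * of_bool (k = 0) + count_list x (k, False) + below_count z k) a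
      \<longleftrightarrow> odd_block (\<lambda>k. of_bool (k = 0) + below_count z k + count_list ((0, False) # x) (k, False)) a"
    by (intro odd_block_cong) auto
  have "odd_word (a @ (0, False) # x @ (0, True) # raise z) \<longleftrightarrow>
      odd_block (\<lambda>k. of_bool (k = 0) + below_count z k + count_list ((0, False) # x) (k, False)) a \<and>
      odd_block (\<lambda>k. of_bool (k \<le> 1) + below_count (z @ a) k) x \<and>
      odd_block (\<lambda>k. of_bool (k = 0) + count_list (a @ x) (k, False)) z"
    unfolding odd_word_split_zero odd_block_append odd_block_Cons odd_block_raise A X Z by simp
  moreover have "odd_word ((z @ a) @ (0, False) # x) \<longleftrightarrow>
      odd_block (\<lambda>k. of_bool (k = 0) + below_count z k + count_list ((0, False) # x) (k, False)) a \<and>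
      odd_block (\<lambda>k. of_bool (k \<le> 1) + below_count (z @ a) k) x \<and>
      odd_block (\<lambda>k. of_bool (k = 0) + count_list (a @ x) (k, False)) z"
    unfolding odd_word_split_zero odd_block_append Z' A' by auto
  ultimately show ?thesis by (simp only: append_assoc)
qed

section \<open>The children of an odd word\<close>

definition odd_words :: "nat \<Rightarrow> (nat \<times> bool) list set" where
  "odd_words n = {w. length w = n \<and> odd_word w}"

definition zero_prefix :: "(nat \<times> bool) list \<Rightarrow> (nat \<times> bool) list" where
  "zero_prefix w = takeWhile (\<lambda>x. x \<noteq> (0, False)) w"

definition zero_suffix :: "(nat \<times> bool) list \<Rightarrow> (nat \<times> bool) list" where
  "zero_suffix w = tl (dropWhile (\<lambda>x. x \<noteq> (0, False)) w)"

definition word_weight :: "'a::comm_ring_1 \<Rightarrow> 'a \<Rightarrow> (nat \<times> bool) list \<Rightarrow> 'a" where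
  "word_weight t z w = t ^ sum_list (map fst w) * z ^ length (filter snd w)"

lemma zero_split_simps [simp]:
  assumes "(0, False) \<notin> set p"
  shows "zero_prefix (p @ (0, False) # q) = p" "zero_suffix (p @ (0, False) # q) = q"
proof -
  have "\<forall>x\<in>set p. x \<noteq> (0, False)" using assms by auto
  then show "zero_prefix (p @ (0, False) # q) = p" "zero_suffix (p @ (0, False) # q) = q"
    by (simp_all add: zero_prefix_def zero_suffix_def)
qed

lemma zero_split:
  assumes "w \<in> odd_words n" "n \<ge> 1"
  shows "w = zero_prefix w @ (0, False) # zero_suffix w"
    and "(0, False) \<notin> set (zero_prefix w)" "(0, False) \<notin> set (zero_suffix w)"
    and "length (zero_prefix w) + length (zero_suffix w) + 1 = n"
proof -
  have "odd_word w" "w \<noteq> []" using assms by (auto simp: odd_words_def)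
  then obtain p q where "w = p @ (0, False) # q" "(0, False) \<notin> set p" "(0, False) \<notin> set q"
    by (rule odd_wordE)
  then show "w = zero_prefix w @ (0, False) # zero_suffix w"
    and "(0, False) \<notin> set (zero_prefix w)" "(0, False) \<notin> set (zero_suffix w)"
    and "length (zero_prefix w) + length (zero_suffix w) + 1 = n"
    using assms(1) by (auto simp: odd_words_def)
qed

lemma append_eq_Cons_split:
  assumes "a @ x # b = a' @ x # b'" "x \<notin> set a" "x \<notin> set a'"
  shows "a = a' \<and> b = b'"
proof -
  have "takeWhile (\<lambda>y. y \<noteq> x) (a @ x # b) = a" "takeWhile (\<lambda>y. y \<noteq> x) (a' @ x # b') = a'"
    by (subst takeWhile_append2, use assms(2,3) in auto)+
  then show ?thesis using assms(1) by simp
qed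

lemma append_Cons_eq_lastD:
  assumes "a @ x # b = a' @ x # b'" "x \<notin> set b" "x \<notin> set b'"
  shows "a = a' \<and> b = b'"
proof -
  have "rev b @ x # rev a = rev b' @ x # rev a'"
    using arg_cong[OF assms(1), of rev] by simp
  then show ?thesis
    using assms(2,3) append_eq_Cons_split[of "rev b" x "rev a" "rev b'" "rev a'"] by simp
qed

text \<open>The rotation of \<open>odd_word_rotate\<close> read backwards, with the cut
  \<open>j\<close> letters behind the old \<open>0\<close>. The old \<open>0\<close> is raised and a
  new one takes its place.\<close>

definition rotate_child :: "(nat \<times> bool) list \<Rightarrow> nat \<Rightarrow> (nat \<times> bool) list" where
  "rotate_child w j = drop j (zero_suffix w) @ (0, False) #
    raise (zero_prefix w @ (0, False) # take j (zero_suffix w))"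

text \<open>\<open>odd_word_decorated\<close> read backwards, with the cut before the old
  \<open>0\<close>, which stays. The new decorated \<open>0\<close> becomes the last letter on
  diagonal \<open>0\<close>, so the cut can be recovered.\<close>

definition decorate_child :: "(nat \<times> bool) list \<Rightarrow> nat \<Rightarrow> (nat \<times> bool) list" where
  "decorate_child w j = drop j (zero_prefix w) @ (0, False) # zero_suffix w @ (0, True) #
    raise (take j (zero_prefix w))"

lemma raise_inject: "raise a = raise b \<longleftrightarrow> a = b"
  by (rule inj_map_eq_map) (auto simp: inj_on_def)

lemma zero_notin_raise [simp]: "(0, b) \<notin> set (raise m)"
  by auto

lemma ex_raise:
  assumes "\<And>b. (0, b) \<notin> set m"
  obtains m' where "m = raise m'"
proof
  have "apfst Suc (apfst (\<lambda>d. d - 1) x) = x" if "x \<in> set m" for x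
    using assms[of "snd x"] that by (cases x; cases "fst x") auto
  then show "m = raise (map (apfst (\<lambda>d. d - 1)) m)"
    by (simp add: map_idI)
qed

lemma sum_fst_raise: "sum_list (map fst (raise m)) = sum_list (map fst m) + length m"
  by (induction m) auto

lemma length_filter_snd_raise: "length (filter snd (raise m)) = length (filter snd m)"
  by (induction m) auto

lemma word_weight_append: "word_weight t z (a @ b) = word_weight t z a * word_weight t z b"
  by (simp add: word_weight_def power_add mult_ac)

lemma word_weight_Cons:
  "word_weight t z (x # b) = t ^ fst x * (if snd x then z else 1) * word_weight t z b"
  by (simp add: word_weight_def power_add mult_ac)

lemma word_weight_raise: "word_weight t z (raise m) = t ^ length m * word_weight t z m"
  by (simp add: word_weight_def sum_fst_raise length_filter_snd_raise power_add mult_ac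
      del: map_map)

lemma word_weight_take_drop:
  "word_weight t z (take j q) * word_weight t z (drop j q) = word_weight t z q"
  by (metis append_take_drop_id word_weight_append)

lemma weight_rotate_child:
  assumes "w \<in> odd_words n" "n \<ge> 1" "j \<le> length (zero_suffix w)"
  shows "word_weight t z (rotate_child w j) =
    word_weight t z w * t ^ (length (zero_prefix w) + 1 + j)"
proof -
  note zs = zero_split[OF assms(1,2)]
  have "word_weight t z w = word_weight t z (zero_prefix w) *
      (word_weight t z (take j (zero_suffix w)) * word_weight t z (drop j (zero_suffix w)))"
    by (subst zs(1)) (simp add: word_weight_append word_weight_Cons word_weight_take_drop)
  then show ?thesis
    unfolding rotate_child_def word_weight_append word_weight_Cons word_weight_raise
    using assms(3) by (simp add: power_add mult_ac)
qed

lemma weight_decorate_child: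
  assumes "w \<in> odd_words n" "n \<ge> 1" "j \<le> length (zero_prefix w)"
  shows "word_weight t z (decorate_child w j) = word_weight t z w * (z * t ^ j)"
proof -
  note zs = zero_split[OF assms(1,2)]
  have "word_weight t z w = (word_weight t z (take j (zero_prefix w)) *
      word_weight t z (drop j (zero_prefix w))) * word_weight t z (zero_suffix w)"
    by (subst zs(1)) (simp add: word_weight_append word_weight_Cons word_weight_take_drop)
  then show ?thesis
    unfolding decorate_child_def word_weight_append word_weight_Cons word_weight_raise
    using assms(3) by (simp add: mult_ac)
qed

lemma rotate_child_split:
  assumes "w \<in> odd_words n" "n \<ge> 1"
  shows "zero_prefix (rotate_child w j) = drop j (zero_suffix w)"
    "zero_suffix (rotate_child w j) = raise (zero_prefix w @ (0, False) # take j (zero_suffix w))"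
  using zero_split(3)[OF assms] set_drop_subset[of j "zero_suffix w"]
  unfolding rotate_child_def by (subst zero_split_simps; blast)+

lemma decorate_child_split:
  assumes "w \<in> odd_words n" "n \<ge> 1"
  shows "zero_prefix (decorate_child w j) = drop j (zero_prefix w)"
    "zero_suffix (decorate_child w j) = zero_suffix w @ (0, True) # raise (take j (zero_prefix w))"
  using zero_split(2)[OF assms] set_drop_subset[of j "zero_prefix w"]
  unfolding decorate_child_def by (subst zero_split_simps; blast)+

text \<open>No letter on diagonal \<open>0\<close> follows the undecorated \<open>0\<close> of such
  a word, so the suffix can be lowered and moved to the front. The result is odd and nonempty; its
  own \<open>0\<close> must lie in the moved part, and this determines \<open>j\<close>.\<close>

lemma bij_rotate_child:
  assumes "n \<ge> 1"
  shows "bij_betw (\<lambda>(w, j). rotate_child w j)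
    (SIGMA w:odd_words n. {..length (zero_suffix w)})
    {w \<in> odd_words (Suc n). (0, True) \<notin> set (zero_suffix w)}"
proof (intro bij_betwI')
  fix u v assume "u \<in> (SIGMA w:odd_words n. {..length (zero_suffix w)})"
    "v \<in> (SIGMA w:odd_words n. {..length (zero_suffix w)})"
  then obtain w j w' j' where uv: "u = (w, j)" "v = (w', j')" "w \<in> odd_words n" "w' \<in> odd_words n"
    "j \<le> length (zero_suffix w)" "j' \<le> length (zero_suffix w')" by auto
  have "w = w' \<and> j = j'" if "rotate_child w j = rotate_child w' j'"
  proof -
    have d: "drop j (zero_suffix w) = drop j' (zero_suffix w')"
      using that rotate_child_split(1)[OF uv(3) assms] rotate_child_split(1)[OF uv(4) assms] by metis
    have "zero_prefix w @ (0, False) # take j (zero_suffix w) =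
        zero_prefix w' @ (0, False) # take j' (zero_suffix w')"
      using that rotate_child_split(2)[OF uv(3) assms] rotate_child_split(2)[OF uv(4) assms]
      by (metis raise_inject)
    then have p: "zero_prefix w = zero_prefix w'" and t: "take j (zero_suffix w) = take j' (zero_suffix w')"
      using zero_split_simps[OF zero_split(2)[OF uv(3) assms]]
        zero_split_simps[OF zero_split(2)[OF uv(4) assms]] by metis+
    have "j = j'" using t uv(5,6) by (metis length_take min.absorb2)
    moreover have "zero_suffix w = zero_suffix w'" using d t by (metis append_take_drop_id)
    ultimately show ?thesis
      using p zero_split(1)[OF uv(3) assms] zero_split(1)[OF uv(4) assms] by metis
  qed
  then show "((\<lambda>(w, j). rotate_child w j) u = (\<lambda>(w, j). rotate_child w j) v) = (u = v)"
    using uv by auto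
next
  fix u assume "u \<in> (SIGMA w:odd_words n. {..length (zero_suffix w)})"
  then obtain w j where u: "u = (w, j)" "w \<in> odd_words n" "j \<le> length (zero_suffix w)" by auto
  note zs = zero_split[OF u(2) assms]
  have "(0, False) \<notin> set (drop j (zero_suffix w))" using zs(3) by (meson in_set_dropD)
  then have "odd_word (rotate_child w j) \<longleftrightarrow>
      odd_word ((zero_prefix w @ (0, False) # take j (zero_suffix w)) @ drop j (zero_suffix w))"
    unfolding rotate_child_def by (rule odd_word_rotate)
  also have "(zero_prefix w @ (0, False) # take j (zero_suffix w)) @ drop j (zero_suffix w) = w"
    using zs(1) by simp
  finally show "(\<lambda>(w, j). rotate_child w j) u
      \<in> {w \<in> odd_words (Suc n). (0, True) \<notin> set (zero_suffix w)}"
    using u zs(4) rotate_child_split(2)[OF u(2) assms]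
    by (auto simp: odd_words_def) (simp add: rotate_child_def)
next
  fix c assume c: "c \<in> {w \<in> odd_words (Suc n). (0, True) \<notin> set (zero_suffix w)}"
  then have c': "c \<in> odd_words (Suc n)" by simp
  note zc = zero_split[OF c', simplified]
  have "(0, b) \<notin> set (zero_suffix c)" for b using c zc(3) by (cases b) auto
  then obtain m where m: "zero_suffix c = raise m" by (rule ex_raise)
  define w where "w = m @ zero_prefix c"
  have "odd_word (zero_prefix c @ (0, False) # raise m)" using c' zc(1) m by (simp add: odd_words_def)
  then have ow: "odd_word w" unfolding w_def using odd_word_rotate[OF zc(2)] by simp
  have lw: "length w = n" using zc(4) m by (simp add: w_def)
  then have "(0, False) \<in> set w" using ow assms by (intro odd_word_zero_exists) auto
  then have "(0, False) \<in> set m" using zc(2) by (simp add: w_def)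
  then obtain p q where pq: "m = p @ (0, False) # q" "(0, False) \<notin> set p" by (meson split_list_first)
  have s: "zero_prefix w = p" "zero_suffix w = q @ zero_prefix c" using pq by (simp_all add: w_def)
  have "rotate_child w (length q) = c"
    unfolding rotate_child_def s using zc(1) m pq by simp
  moreover have "(w, length q) \<in> (SIGMA w:odd_words n. {..length (zero_suffix w)})"
    using ow lw s by (simp add: odd_words_def)
  ultimately show "\<exists>x\<in>SIGMA w:odd_words n. {..length (zero_suffix w)}. c = (\<lambda>(w, j). rotate_child w j) x"
    by force
qed

text \<open>The inverse cuts at the last decorated \<open>0\<close>. Oddness of its schedule number
  forces an even number of undecorated \<open>0\<close>s into the lowered remainder, and
  \<open>odd_block_count_le_1\<close> allows at most one; so there is none, as
  \<open>odd_word_decorated\<close> demands.\<close>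

lemma bij_decorate_child:
  assumes "n \<ge> 1"
  shows "bij_betw (\<lambda>(w, j). decorate_child w j)
    (SIGMA w:odd_words n. {..length (zero_prefix w)})
    {w \<in> odd_words (Suc n). (0, True) \<in> set (zero_suffix w)}"
proof (intro bij_betwI')
  fix u v assume "u \<in> (SIGMA w:odd_words n. {..length (zero_prefix w)})"
    "v \<in> (SIGMA w:odd_words n. {..length (zero_prefix w)})"
  then obtain w j w' j' where uv: "u = (w, j)" "v = (w', j')" "w \<in> odd_words n" "w' \<in> odd_words n"
    "j \<le> length (zero_prefix w)" "j' \<le> length (zero_prefix w')" by auto
  have "w = w' \<and> j = j'" if "decorate_child w j = decorate_child w' j'"
  proof -
    have d: "drop j (zero_prefix w) = drop j' (zero_prefix w')"
      using that decorate_child_split(1)[OF uv(3) assms] decorate_child_split(1)[OF uv(4) assms] by metis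
    have "zero_suffix w @ (0, True) # raise (take j (zero_prefix w)) =
        zero_suffix w' @ (0, True) # raise (take j' (zero_prefix w'))"
      using that decorate_child_split(2)[OF uv(3) assms] decorate_child_split(2)[OF uv(4) assms]
      by metis
    then have p: "zero_suffix w = zero_suffix w'" and t: "take j (zero_prefix w) = take j' (zero_prefix w')"
      by (auto dest!: append_Cons_eq_lastD simp: raise_inject simp del: set_map)
    have "j = j'" using t uv(5,6) by (metis length_take min.absorb2)
    moreover have "zero_prefix w = zero_prefix w'" using d t by (metis append_take_drop_id)
    ultimately show ?thesis
      using p zero_split(1)[OF uv(3) assms] zero_split(1)[OF uv(4) assms] by metis
  qed
  then show "((\<lambda>(w, j). decorate_child w j) u = (\<lambda>(w, j). decorate_child w j) v) = (u = v)"
    using uv by auto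
next
  fix u assume "u \<in> (SIGMA w:odd_words n. {..length (zero_prefix w)})"
  then obtain w j where u: "u = (w, j)" "w \<in> odd_words n" "j \<le> length (zero_prefix w)" by auto
  note zs = zero_split[OF u(2) assms]
  have "(0, False) \<notin> set (drop j (zero_prefix w))" "(0, False) \<notin> set (take j (zero_prefix w))"
    using zs(2) by (meson in_set_dropD in_set_takeD)+
  then have "odd_word (decorate_child w j) \<longleftrightarrow>
      odd_word (take j (zero_prefix w) @ drop j (zero_prefix w) @ (0, False) # zero_suffix w)"
    unfolding decorate_child_def using zs(3) by (intro odd_word_decorated)
  also have "take j (zero_prefix w) @ drop j (zero_prefix w) @ (0, False) # zero_suffix w = w"
    using zs(1) by (metis append.assoc append_take_drop_id)
  finally show "(\<lambda>(w, j). decorate_child w j) u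
      \<in> {w \<in> odd_words (Suc n). (0, True) \<in> set (zero_suffix w)}"
    using u zs(4) decorate_child_split(2)[OF u(2) assms]
    by (auto simp: odd_words_def) (simp add: decorate_child_def)
next
  fix c assume c: "c \<in> {w \<in> odd_words (Suc n). (0, True) \<in> set (zero_suffix w)}"
  then have c': "c \<in> odd_words (Suc n)" and "(0, True) \<in> set (zero_suffix c)" by simp_all
  then obtain x y where xy: "zero_suffix c = x @ (0, True) # y" "(0, True) \<notin> set y"
    using split_list_last[of "(0, True)" "zero_suffix c"] by blast
  note zc = zero_split[OF c', simplified]
  have "(0, b) \<notin> set y" for b using xy zc(3) by (cases b) auto
  then obtain m where m: "y = raise m" by (rule ex_raise)
  have cw: "c = (zero_prefix c @ (0, False) # x) @ (0, True) # raise m"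
    using zc(1) xy(1) m by simp
  have oc: "odd_block (\<lambda>k. of_bool (k = 0)) c" using c' by (simp add: odd_words_def odd_word_def)
  have "count_list (zero_prefix c) (0, False) = 0" "count_list x (0, False) = 0"
    using zc(2,3) xy(1) by (auto simp: count_list_0_iff)
  then have "even (count_list m (0, False))"
    using odd_blockD[OF oc cw] by simp
  moreover have "count_list m (0, False) \<le> 1"
  proof -
    have "((zero_prefix c @ (0, False) # x) @ [(0, True)]) @ raise m = c" using cw by simp
    then have "odd_block (\<lambda>k. of_bool (k = 0))
        (((zero_prefix c @ (0, False) # x) @ [(0, True)]) @ raise m)" using oc by (simp only:)
    from this[unfolded odd_block_append[of _ _ "raise m"], THEN conjunct2, unfolded odd_block_raise]
    show ?thesis by (rule odd_block_count_le_1) simp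
  qed
  ultimately have "count_list m (0, False) = 0" by (cases "count_list m (0, False)") auto
  then have zm: "(0, False) \<notin> set m" by (simp add: count_list_0_iff)
  define w where "w = m @ zero_prefix c @ (0, False) # x"
  have zx: "(0, False) \<notin> set x" using zc(3) xy(1) by simp
  have "odd_word (zero_prefix c @ (0, False) # x @ (0, True) # raise m)"
    using c' cw by (simp add: odd_words_def)
  then have ow: "odd_word w" unfolding w_def using odd_word_decorated[OF zc(2) zx zm] by simp
  have lw: "length w = n" using zc(4) xy(1) m by (simp add: w_def)
  have "w = (m @ zero_prefix c) @ (0, False) # x" by (simp add: w_def)
  then have s: "zero_prefix w = m @ zero_prefix c" "zero_suffix w = x"
    using zm zc(2) zero_split_simps[of "m @ zero_prefix c" x] by simp_all
  have "decorate_child w (length m) = c"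
    unfolding decorate_child_def s using cw by simp
  moreover have "(w, length m) \<in> (SIGMA w:odd_words n. {..length (zero_prefix w)})"
    using ow lw s by (simp add: odd_words_def)
  ultimately show "\<exists>x\<in>SIGMA w:odd_words n. {..length (zero_prefix w)}. c = (\<lambda>(w, j). decorate_child w j) x"
    by force
qed

lemma odd_words_1: "odd_words 1 = {[(0, False)]}"
proof (intro equalityI subsetI)
  fix w assume w: "w \<in> odd_words 1"
  from zero_split(1,4)[OF w] show "w \<in> {[(0, False)]}" by simp
qed (simp add: odd_words_def odd_word_def odd_block_single)

text \<open>Diagonals are not bounded a priori; finiteness comes from every longer odd word being a
  child.\<close>

lemma finite_odd_words: "n \<ge> 1 \<Longrightarrow> finite (odd_words n)"
proof (induction n rule: nat_induct_at_least)
  case base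
  show ?case unfolding odd_words_1 by simp
next
  case (Suc n)
  have "finite {w \<in> odd_words (Suc n). (0, True) \<notin> set (zero_suffix w)}"
    using bij_betw_finite[OF bij_rotate_child[OF Suc.hyps]] Suc.IH by auto
  moreover have "finite {w \<in> odd_words (Suc n). (0, True) \<in> set (zero_suffix w)}"
    using bij_betw_finite[OF bij_decorate_child[OF Suc.hyps]] Suc.IH by auto
  ultimately have "finite ({w \<in> odd_words (Suc n). (0, True) \<notin> set (zero_suffix w)} \<union>
      {w \<in> odd_words (Suc n). (0, True) \<in> set (zero_suffix w)})" by simp
  then show ?case by (rule rev_finite_subset) auto
qed

text \<open>The recursion shared by words and permutations, acting on functions \<open>f\<close> of the rank. The rank of
  a word is 1 plus the length of the part after its undecorated \<open>0\<close>.\<close>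

definition rank_step :: "'a::comm_ring_1 \<Rightarrow> 'a \<Rightarrow> nat \<Rightarrow> (nat \<Rightarrow> 'a) \<Rightarrow> nat \<Rightarrow> 'a" where
  "rank_step t z n f r =
    (\<Sum>j<r. t ^ (n - r + 1 + j) * f (n - r + 2 + j)) + (\<Sum>j\<le>n - r. z * t ^ j * f (r + 1 + j))"

text \<open>With \<open>a\<close> letters before and \<open>b\<close> letters after the
  \<open>0\<close>, the rank is \<open>r = b + 1\<close> and \<open>n - r = a\<close>. A rotation
  with \<open>j \<le> b\<close> raises \<open>a + 1 + j\<close> letters, which become the new
  suffix; a decoration with \<open>j \<le> a\<close> raises \<open>j\<close> letters and lengthens
  the suffix to \<open>b + 1 + j\<close>.\<close>

lemma odd_words_rec:
  assumes n: "n \<ge> 1"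
  shows "(\<Sum>w\<in>odd_words (Suc n). word_weight t z w * f (Suc (length (zero_suffix w)))) =
    (\<Sum>w\<in>odd_words n. word_weight t z w * rank_step t z n f (Suc (length (zero_suffix w))))"
proof -
  let ?g = "\<lambda>w. word_weight t z w * f (Suc (length (zero_suffix w)))"
  note fin = finite_odd_words[OF n]
  have "sum ?g (odd_words (Suc n)) =
      sum ?g ({w \<in> odd_words (Suc n). (0, True) \<notin> set (zero_suffix w)} \<union>
        {w \<in> odd_words (Suc n). (0, True) \<in> set (zero_suffix w)})"
    by (rule sum.cong) auto
  also have "\<dots> = sum ?g {w \<in> odd_words (Suc n). (0, True) \<notin> set (zero_suffix w)} +
      sum ?g {w \<in> odd_words (Suc n). (0, True) \<in> set (zero_suffix w)}"
    using finite_odd_words[of "Suc n"] by (intro sum.union_disjoint) auto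
  also have "sum ?g {w \<in> odd_words (Suc n). (0, True) \<notin> set (zero_suffix w)} =
      (\<Sum>(w, j)\<in>(SIGMA w:odd_words n. {..length (zero_suffix w)}). ?g (rotate_child w j))"
    by (subst sum.reindex_bij_betw[OF bij_rotate_child[OF n], symmetric]) (simp add: case_prod_unfold)
  also have "\<dots> = (\<Sum>w\<in>odd_words n. \<Sum>j\<le>length (zero_suffix w). ?g (rotate_child w j))"
    by (rule sum.Sigma[symmetric]) (use fin in auto)
  also have "sum ?g {w \<in> odd_words (Suc n). (0, True) \<in> set (zero_suffix w)} =
      (\<Sum>(w, j)\<in>(SIGMA w:odd_words n. {..length (zero_prefix w)}). ?g (decorate_child w j))"
    by (subst sum.reindex_bij_betw[OF bij_decorate_child[OF n], symmetric]) (simp add: case_prod_unfold)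
  also have "\<dots> = (\<Sum>w\<in>odd_words n. \<Sum>j\<le>length (zero_prefix w). ?g (decorate_child w j))"
    by (rule sum.Sigma[symmetric]) (use fin in auto)
  also have "(\<Sum>w\<in>odd_words n. \<Sum>j\<le>length (zero_suffix w). ?g (rotate_child w j)) +
      (\<Sum>w\<in>odd_words n. \<Sum>j\<le>length (zero_prefix w). ?g (decorate_child w j)) =
    (\<Sum>w\<in>odd_words n. word_weight t z w * rank_step t z n f (Suc (length (zero_suffix w))))"
    unfolding sum.distrib[symmetric]
  proof (rule sum.cong[OF refl])
    fix w assume w: "w \<in> odd_words n"
    let ?a = "length (zero_prefix w)" and ?b = "length (zero_suffix w)"
    have len: "?a + ?b + 1 = n" by (rule zero_split(4)[OF w n])
    have "(\<Sum>j\<le>?b. ?g (rotate_child w j)) =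
        (\<Sum>j\<le>?b. word_weight t z w * (t ^ (n - Suc ?b + 1 + j) * f (n - Suc ?b + 2 + j)))"
      using len by (intro sum.cong)
        (auto simp: weight_rotate_child[OF w n] rotate_child_split[OF w n] mult_ac
          simp flip: len)
    moreover have "(\<Sum>j\<le>?a. ?g (decorate_child w j)) =
        (\<Sum>j\<le>n - Suc ?b. word_weight t z w * (z * t ^ j * f (Suc ?b + 1 + j)))"
      using len by (intro sum.cong)
        (auto simp: weight_decorate_child[OF w n] decorate_child_split[OF w n] mult_ac
          simp flip: len)
    ultimately show "(\<Sum>j\<le>?b. ?g (rotate_child w j)) + (\<Sum>j\<le>?a. ?g (decorate_child w j)) =
        word_weight t z w * rank_step t z n f (Suc ?b)"
      by (simp add: rank_step_def distrib_left sum_distrib_left lessThan_Suc_atMost)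
  qed
  finally show ?thesis .
qed

section \<open>Appending a value to a permutation\<close>

text \<open>The shift of the values \<open>\<ge> v\<close> keeps the relative order of the first
  \<open>n\<close> values, and argument 0 is fixed, so the convention for index 0 survives.\<close>

definition append_value :: "nat \<Rightarrow> (nat \<Rightarrow> nat) \<Rightarrow> nat \<Rightarrow> nat \<Rightarrow> nat" where
  "append_value n \<tau> v i =
    (if i = Suc n then v else if i \<in> {1..n} then (if \<tau> i < v then \<tau> i else Suc (\<tau> i)) else i)"

text \<open>Complementing the last value after a descent makes the recursion independent of whether the
  permutation ends with an ascent or a descent.\<close>

definition last_rank :: "nat \<Rightarrow> (nat \<Rightarrow> nat) \<Rightarrow> nat" where
  "last_rank n \<sigma> = (if \<sigma> (n - 1) < \<sigma> n then \<sigma> n else Suc n - \<sigma> n)"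

lemma append_value_permutes:
  assumes "\<tau> permutes {1..n}" "v \<in> {1..Suc n}"
  shows "append_value n \<tau> v permutes {1..Suc n}"
proof (rule bij_imp_permutes)
  have range: "\<tau> i \<in> {1..n}" if "i \<in> {1..n}" for i
    using permutes_in_image[OF assms(1)] that by blast
  have inj: "i = j" if "\<tau> i = \<tau> j" for i j
    using permutes_inj[OF assms(1)] that by (simp add: inj_def)
  have "inj_on (append_value n \<tau> v) {1..Suc n}"
    by (rule inj_onI) (auto simp: append_value_def split: if_splits dest: inj)
  moreover have "append_value n \<tau> v ` {1..Suc n} \<subseteq> {1..Suc n}"
    using assms(2) range by (fastforce simp: append_value_def)
  ultimately show "bij_betw (append_value n \<tau> v) {1..Suc n} {1..Suc n}"
    unfolding bij_betw_def using endo_inj_surj[of "{1..Suc n}"] by blast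
qed (auto simp: append_value_def)

text \<open>Injectivity suffices, as both sides have \<open>fact (Suc n)\<close> elements.\<close>

lemma bij_append_value:
  "bij_betw (\<lambda>(\<tau>, v). append_value n \<tau> v) ({\<tau>. \<tau> permutes {1..n}} \<times> {1..Suc n})
    {\<sigma>. \<sigma> permutes {1..Suc n}}"
proof -
  let ?A = "{\<tau>. \<tau> permutes {1..n}} \<times> {1..Suc n}" and ?B = "{\<sigma>. \<sigma> permutes {1..Suc n}}"
  let ?f = "\<lambda>(\<tau>, v). append_value n \<tau> v"
  have inj: "inj_on ?f ?A"
  proof (rule inj_onI, clarify)
    fix \<tau> v \<tau>' v'
    assume \<tau>: "\<tau> permutes {1..n}" "\<tau>' permutes {1..n}"
      and eq: "append_value n \<tau> v = append_value n \<tau>' v'"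
    have "append_value n \<tau> v (Suc n) = append_value n \<tau>' v' (Suc n)" using eq by simp
    then have v: "v = v'" by (simp add: append_value_def)
    have "\<tau> i = \<tau>' i" for i
    proof (cases "i \<in> {1..n}")
      case True
      have "append_value n \<tau> v i = append_value n \<tau>' v' i" using eq by simp
      with True v show ?thesis by (auto simp: append_value_def split: if_splits)
    next
      case False
      then show ?thesis using \<tau> by (metis permutes_not_in)
    qed
    with v show "\<tau> = \<tau>' \<and> v = v'" by auto
  qed
  moreover have "?f ` ?A = ?B"
  proof (rule card_subset_eq)
    show "finite ?B" by (simp add: finite_permutations)
    show "?f ` ?A \<subseteq> ?B" using append_value_permutes by auto
    have "card (?f ` ?A) = card ?A" by (rule card_image[OF inj])
    also have "\<dots> = fact (Suc n)"
      by (simp add: card_cartesian_product card_permutations[OF refl, simplified])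
    also have "\<dots> = card ?B" by (simp add: card_permutations[OF refl, simplified])
    finally show "card (?f ` ?A) = card ?B" .
  qed
  ultimately show ?thesis by (simp add: bij_betw_def)
qed

text \<open>Grouping by the right index \<open>j\<close> pays off because everything at
  \<open>j\<close> depends on positions up to \<open>j\<close> only; an appended value adds just the
  group of the last index.\<close>

definition inv3_at :: "(nat \<Rightarrow> nat) \<Rightarrow> nat \<Rightarrow> nat set" where
  "inv3_at \<sigma> j = {i. 1 \<le> i \<and> i < j \<and>
    (double_ascent \<sigma> j \<and> \<sigma> (j - 1) < \<sigma> i \<and> \<sigma> i < \<sigma> j \<or>
     double_descent \<sigma> j \<and> \<sigma> (j - 1) > \<sigma> i \<and> \<sigma> i > \<sigma> j \<or>
     peak \<sigma> j \<and> \<sigma> i > \<sigma> j \<or>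
     valley \<sigma> j \<and> \<sigma> i < \<sigma> j)}"

lemma inv3_sum: "inv3 n \<sigma> = (\<Sum>j = 1..n. card (inv3_at \<sigma> j))"
proof -
  have fin: "finite (inv3_at \<sigma> j)" for j
    by (rule finite_subset[of _ "{..<j}"]) (auto simp: inv3_at_def)
  have "inv3 n \<sigma> = card (prod.swap ` (SIGMA j:{1..n}. inv3_at \<sigma> j))"
    unfolding inv3_def by (rule arg_cong[of _ _ card]) (force simp: inv3_at_def)
  also have "\<dots> = card (SIGMA j:{1..n}. inv3_at \<sigma> j)"
    by (rule card_image) simp
  also have "\<dots> = (\<Sum>j = 1..n. card (inv3_at \<sigma> j))"
    using fin by simp
  finally show ?thesis .
qed

context
  fixes n v :: nat and \<tau> :: "nat \<Rightarrow> nat"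
  assumes n: "n \<ge> 1" and \<tau>: "\<tau> permutes {1..n}" and v: "v \<in> {1..Suc n}"
begin

lemma append_value_le:
  "i \<le> n \<Longrightarrow> append_value n \<tau> v i = (if \<tau> i < v then \<tau> i else Suc (\<tau> i))"
  using v permutes_not_in[OF \<tau>, of 0] by (cases i) (auto simp: append_value_def)

lemma append_value_less:
  "i \<le> n \<Longrightarrow> j \<le> n \<Longrightarrow> append_value n \<tau> v i < append_value n \<tau> v j \<longleftrightarrow> \<tau> i < \<tau> j"
  by (auto simp: append_value_le)

lemma append_value_last:
  "append_value n \<tau> v (Suc n) = v"
  by (simp add: append_value_def)

lemma append_value_less_last:
  "i \<le> n \<Longrightarrow> append_value n \<tau> v i < v \<longleftrightarrow> \<tau> i < v"
  "i \<le> n \<Longrightarrow> v < append_value n \<tau> v i \<longleftrightarrow> v \<le> \<tau> i"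
  by (auto simp: append_value_le)

lemma last_value: "\<tau> n \<in> {1..n}" "\<tau> (n - 1) \<noteq> \<tau> n"
proof -
  show "\<tau> n \<in> {1..n}" using permutes_in_image[OF \<tau>, of n] n by simp
  show "\<tau> (n - 1) \<noteq> \<tau> n" using inj_eq[OF permutes_inj[OF \<tau>], of "n - 1" n] n by simp
qed

lemma monot_append_value:
  "monot (Suc n) (append_value n \<tau> v) =
    monot n \<tau> + of_bool (\<tau> (n - 1) < \<tau> n \<longleftrightarrow> \<tau> n < v)"
proof -
  let ?\<sigma> = "append_value n \<tau> v"
  let ?P = "\<lambda>\<sigma> i. double_ascent \<sigma> i \<or> double_descent \<sigma> i"
  have "{i \<in> {2..Suc n}. ?P ?\<sigma> i} = {i \<in> {2..n}. ?P ?\<sigma> i} \<union> {i \<in> {Suc n}. ?P ?\<sigma> i}"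
    using n by (auto simp: le_Suc_eq)
  then have "monot (Suc n) ?\<sigma> = card {i \<in> {2..n}. ?P ?\<sigma> i} + card {i \<in> {Suc n}. ?P ?\<sigma> i}"
    unfolding monot_def by (simp only:) (rule card_Un_disjoint; auto)
  also have "{i \<in> {2..n}. ?P ?\<sigma> i} = {i \<in> {2..n}. ?P \<tau> i}"
    by (auto simp: double_ascent_def double_descent_def append_value_less)
  also have "?P ?\<sigma> (Suc n) \<longleftrightarrow> (\<tau> (n - 1) < \<tau> n \<longleftrightarrow> \<tau> n < v)"
    using n last_value by (auto simp: double_ascent_def double_descent_def append_value_less
        append_value_last append_value_less_last)
  then have "card {i \<in> {Suc n}. ?P ?\<sigma> i} = of_bool (\<tau> (n - 1) < \<tau> n \<longleftrightarrow> \<tau> n < v)"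
    by (cases "?P ?\<sigma> (Suc n)") (auto simp: Collect_conv_if)
  finally show ?thesis by (simp add: monot_def)
qed

lemma shape_append_value:
  "double_ascent (append_value n \<tau> v) (Suc n) \<longleftrightarrow> \<tau> (n - 1) < \<tau> n \<and> \<tau> n < v"
  "double_descent (append_value n \<tau> v) (Suc n) \<longleftrightarrow> \<not> \<tau> (n - 1) < \<tau> n \<and> \<not> \<tau> n < v"
  "peak (append_value n \<tau> v) (Suc n) \<longleftrightarrow> \<tau> (n - 1) < \<tau> n \<and> \<not> \<tau> n < v"
  "valley (append_value n \<tau> v) (Suc n) \<longleftrightarrow> \<not> \<tau> (n - 1) < \<tau> n \<and> \<tau> n < v"
  using n last_value(2)
  by (auto simp: double_ascent_def double_descent_def peak_def valley_def append_value_less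
      append_value_last append_value_less_last)

text \<open>The cases are double ascent, peak, valley and double descent, in this order. The
  intervals refer to values of \<open>\<tau>\<close>, before the shift: a value equal to
  \<open>v\<close> exceeds \<open>v\<close> afterwards, hence the closed lower ends at
  \<open>v\<close>.\<close>

lemma inv3_at_append_value:
  "inv3_at (append_value n \<tau> v) (Suc n) = {i \<in> {1..n}. \<tau> i \<in>
    (if \<tau> (n - 1) < \<tau> n then (if \<tau> n < v then {Suc (\<tau> n)..<v} else {v..<Suc n})
     else (if \<tau> n < v then {1..<v} else {v..<\<tau> n}))}" (is "_ = {i \<in> _. \<tau> i \<in> ?S}")
proof -
  have "i \<in> inv3_at (append_value n \<tau> v) (Suc n) \<longleftrightarrow> \<tau> i \<in> ?S" if "i \<in> {1..n}" for i
  proof -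
    have "\<tau> i \<in> {1..n}" using permutes_in_image[OF \<tau>] that by blast
    then show ?thesis using that
      by (simp add: inv3_at_def shape_append_value append_value_less append_value_last
          append_value_less_last) auto
  qed
  moreover have "inv3_at (append_value n \<tau> v) (Suc n) \<subseteq> {1..n}"
    unfolding inv3_at_def by auto
  ultimately show ?thesis by blast
qed

lemma card_permutes_vimage:
  assumes "S \<subseteq> {1..n}"
  shows "card {i \<in> {1..n}. \<tau> i \<in> S} = card S"
proof -
  have "card {i \<in> {1..n}. \<tau> i \<in> S} = card (\<tau> ` {i \<in> {1..n}. \<tau> i \<in> S})"
    by (rule card_image[symmetric]) (rule inj_on_subset[OF permutes_inj[OF \<tau>]], simp)
  also have "\<tau> ` {i \<in> {1..n}. \<tau> i \<in> S} = \<tau> ` {1..n} \<inter> S" by blast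
  also have "\<dots> = S" using permutes_image[OF \<tau>] assms by blast
  finally show ?thesis .
qed

lemma inv3_append_value:
  "inv3 (Suc n) (append_value n \<tau> v) = inv3 n \<tau> +
    (if \<tau> (n - 1) < \<tau> n then (if \<tau> n < v then v - 1 - \<tau> n else Suc n - v)
     else (if \<tau> n < v then v - 1 else \<tau> n - v))"
proof -
  have "inv3_at (append_value n \<tau> v) j = inv3_at \<tau> j" if "j \<in> {1..n}" for j
  proof (intro set_eqI)
    fix i
    show "i \<in> inv3_at (append_value n \<tau> v) j \<longleftrightarrow> i \<in> inv3_at \<tau> j"
    proof (cases "i < j")
      case True
      then have "i \<le> n" "j \<le> n" "j - 1 \<le> n" "j - 2 \<le> n" using that by auto
      then show ?thesis
        by (simp add: inv3_at_def double_ascent_def double_descent_def peak_def valley_def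
            append_value_less)
    qed (simp add: inv3_at_def)
  qed
  then have "inv3 (Suc n) (append_value n \<tau> v) =
      inv3 n \<tau> + card (inv3_at (append_value n \<tau> v) (Suc n))"
    by (simp add: inv3_sum)
  moreover have "card (inv3_at (append_value n \<tau> v) (Suc n)) =
    (if \<tau> (n - 1) < \<tau> n then (if \<tau> n < v then v - 1 - \<tau> n else Suc n - v)
     else (if \<tau> n < v then v - 1 else \<tau> n - v))"
    unfolding inv3_at_append_value using v last_value(1) by (subst card_permutes_vimage) auto
  ultimately show ?thesis by (simp only:)
qed

lemma last_rank_append_value:
  "last_rank (Suc n) (append_value n \<tau> v) = (if \<tau> n < v then v else Suc (Suc n) - v)"
  using n by (simp add: last_rank_def append_value_last append_value_less_last)

end

definition perm_weight :: "'a::comm_ring_1 \<Rightarrow> 'a \<Rightarrow> nat \<Rightarrow> (nat \<Rightarrow> nat) \<Rightarrow> 'a" where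
  "perm_weight t z n \<sigma> = t ^ inv3 n \<sigma> * z ^ monot n \<sigma>"

lemma perm_weight_append_value:
  assumes "n \<ge> 1" "\<tau> permutes {1..n}" "v \<in> {1..Suc n}"
  shows "perm_weight t z (Suc n) (append_value n \<tau> v) = perm_weight t z n \<tau> *
    (z ^ of_bool (\<tau> (n - 1) < \<tau> n \<longleftrightarrow> \<tau> n < v) *
     t ^ (if \<tau> (n - 1) < \<tau> n then (if \<tau> n < v then v - 1 - \<tau> n else Suc n - v)
     else (if \<tau> n < v then v - 1 else \<tau> n - v)))"
  unfolding perm_weight_def monot_append_value[OF assms] inv3_append_value[OF assms] power_add
  by (simp only: mult_ac)

text \<open>The values up to \<open>\<tau> n\<close> and those above it give the two sums of
  \<open>rank_step\<close>: peaks and double ascents after an ascent, double descents and valleys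
  after a descent. In each half, \<open>j\<close> is the distance of \<open>v\<close> from the end
  next to the boundary between the halves.\<close>

lemma sum_append_value:
  assumes n: "n \<ge> 1" and \<tau>: "\<tau> permutes {1..n}"
  shows "(\<Sum>v\<in>{1..Suc n}. perm_weight t z (Suc n) (append_value n \<tau> v) *
      f (last_rank (Suc n) (append_value n \<tau> v))) =
    perm_weight t z n \<tau> * rank_step t z n f (last_rank n \<tau>)"
proof -
  let ?g = "\<lambda>v. perm_weight t z (Suc n) (append_value n \<tau> v) *
      f (last_rank (Suc n) (append_value n \<tau> v))"
  let ?a = "\<tau> n" and ?w = "perm_weight t z n \<tau>"
  have a: "?a \<in> {1..n}" using permutes_in_image[OF \<tau>, of n] n by simp
  have "{1..Suc n} = {1..?a} \<union> {Suc ?a..Suc n}" using a by auto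
  then have split: "sum ?g {1..Suc n} = sum ?g {1..?a} + sum ?g {Suc ?a..Suc n}"
    by (simp only:) (rule sum.union_disjoint; auto)
  show ?thesis
  proof (cases "\<tau> (n - 1) < ?a")
    case True
    have "sum ?g {1..?a} = (\<Sum>v\<in>{1..?a}. ?w * (t ^ (Suc n - v) * f (Suc (Suc n) - v)))"
      using a True by (intro sum.cong) (auto simp: perm_weight_append_value[OF n \<tau>]
        last_rank_append_value[OF n \<tau>] mult.assoc)
    also have "\<dots> = (\<Sum>j<?a. ?w * (t ^ (n - ?a + 1 + j) * f (n - ?a + 2 + j)))"
      using a by (intro sum.reindex_bij_witness[of _ "\<lambda>j. ?a - j" "\<lambda>v. ?a - v"])
        (auto simp: Suc_diff_le intro!: arg_cong2[of _ _ _ _ "(*)"] arg_cong[of _ _ f] arg_cong[of _ _ "(^) t"])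
    finally have 1: "sum ?g {1..?a} = \<dots>" .
    have "sum ?g {Suc ?a..Suc n} = (\<Sum>v\<in>{Suc ?a..Suc n}. ?w * (z * t ^ (v - 1 - ?a) * f v))"
      using a True by (intro sum.cong) (auto simp: perm_weight_append_value[OF n \<tau>]
        last_rank_append_value[OF n \<tau>] mult.assoc)
    also have "\<dots> = (\<Sum>j\<le>n - ?a. ?w * (z * t ^ j * f (?a + 1 + j)))"
      using a by (intro sum.reindex_bij_witness[of _ "\<lambda>j. ?a + 1 + j" "\<lambda>v. v - 1 - ?a"]) auto
    finally show ?thesis unfolding split 1
      using True by (simp add: rank_step_def last_rank_def distrib_left sum_distrib_left)
  next
    case False
    have "sum ?g {1..?a} = (\<Sum>v\<in>{1..?a}. ?w * (z * t ^ (?a - v) * f (Suc (Suc n) - v)))"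
      using a False by (intro sum.cong) (auto simp: perm_weight_append_value[OF n \<tau>]
        last_rank_append_value[OF n \<tau>] mult.assoc)
    also have "\<dots> = (\<Sum>j\<le>n - (Suc n - ?a). ?w * (z * t ^ j * f (Suc n - ?a + 1 + j)))"
      using a by (intro sum.reindex_bij_witness[of _ "\<lambda>j. ?a - j" "\<lambda>v. ?a - v"])
        (auto simp: Suc_diff_le intro!: arg_cong2[of _ _ _ _ "(*)"] arg_cong[of _ _ f])
    finally have 1: "sum ?g {1..?a} = \<dots>" .
    have "sum ?g {Suc ?a..Suc n} = (\<Sum>v\<in>{Suc ?a..Suc n}. ?w * (t ^ (v - 1) * f v))"
      using a False by (intro sum.cong) (auto simp: perm_weight_append_value[OF n \<tau>]
        last_rank_append_value[OF n \<tau>] mult.assoc)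
    also have "\<dots> = (\<Sum>j<Suc n - ?a. ?w * (t ^ (n - (Suc n - ?a) + 1 + j) *
        f (n - (Suc n - ?a) + 2 + j)))"
      using a by (intro sum.reindex_bij_witness[of _ "\<lambda>j. ?a + 1 + j" "\<lambda>v. v - 1 - ?a"])
        (auto simp: Suc_diff_le intro!: arg_cong2[of _ _ _ _ "(*)"] arg_cong[of _ _ f] arg_cong[of _ _ "(^) t"])
    finally have 2: "sum ?g {Suc ?a..Suc n} = \<dots>" .
    show ?thesis unfolding split 1 2
      using False by (simp add: rank_step_def last_rank_def distrib_left sum_distrib_left add.commute)
  qed
qed

lemma permutations_rec:
  assumes n: "n \<ge> 1"
  shows "(\<Sum>\<sigma> | \<sigma> permutes {1..Suc n}. perm_weight t z (Suc n) \<sigma> * f (last_rank (Suc n) \<sigma>)) =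
    (\<Sum>\<tau> | \<tau> permutes {1..n}. perm_weight t z n \<tau> * rank_step t z n f (last_rank n \<tau>))"
proof -
  have "(\<Sum>\<sigma> | \<sigma> permutes {1..Suc n}. perm_weight t z (Suc n) \<sigma> * f (last_rank (Suc n) \<sigma>)) =
    (\<Sum>(\<tau>, v)\<in>{\<tau>. \<tau> permutes {1..n}} \<times> {1..Suc n}. perm_weight t z (Suc n) (append_value n \<tau> v) *
      f (last_rank (Suc n) (append_value n \<tau> v)))"
    by (subst sum.reindex_bij_betw[OF bij_append_value, symmetric]) (simp add: case_prod_unfold)
  also have "\<dots> = (\<Sum>\<tau> | \<tau> permutes {1..n}. \<Sum>v\<in>{1..Suc n}.
      perm_weight t z (Suc n) (append_value n \<tau> v) * f (last_rank (Suc n) (append_value n \<tau> v)))"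
    by (rule sum.cartesian_product[symmetric])
  also have "\<dots> = (\<Sum>\<tau> | \<tau> permutes {1..n}. perm_weight t z n \<tau> * rank_step t z n f (last_rank n \<tau>))"
    by (intro sum.cong refl sum_append_value[OF n]) simp
  finally show ?thesis .
qed

text \<open>Both recursions push the last step onto the test function, so the induction hypothesis
  is applied to \<open>rank_step t z n f\<close>; this is why \<open>f\<close> is arbitrary.\<close>

lemma odd_words_permutations_ranked:
  assumes "n \<ge> 1"
  shows "(\<Sum>w\<in>odd_words n. word_weight t z w * f (Suc (length (zero_suffix w)))) =
    (\<Sum>\<sigma> | \<sigma> permutes {1..n}. perm_weight t z n \<sigma> * f (last_rank n \<sigma>))"
  using assms
proof (induction n arbitrary: f rule: nat_induct_at_least)
  case base
  have "inv3 1 (\<lambda>a. a) = 0" by (simp add: inv3_sum inv3_at_def)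
  moreover have "monot 1 (\<lambda>a. a) = 0" by (simp add: monot_def)
  moreover have "zero_suffix [(0, False)] = []" by (simp add: zero_suffix_def)
  ultimately show ?case
    unfolding odd_words_1 by (simp add: perm_weight_def word_weight_def last_rank_def)
next
  case (Suc n)
  show ?case unfolding odd_words_rec[OF Suc.hyps] permutations_rec[OF Suc.hyps] by (rule Suc.IH)
qed

lemma odd_words_permutations:
  "n \<ge> 1 \<Longrightarrow> sum (word_weight t z) (odd_words n) =
    (\<Sum>\<sigma> | \<sigma> permutes {1..n}. t ^ inv3 n \<sigma> * z ^ monot n \<sigma>)"
  using odd_words_permutations_ranked[of n t z "\<lambda>_. 1"] by (simp add: perm_weight_def)

section \<open>Signed enumeration of labelled paths\<close>

text \<open>An entry is a north step: its label, its diagonal plus 1, and whether it is decorated. The shift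
  makes room for the undecorated sentinel \<open>origin\<close> on level 0, which precedes every path.\<close>

type_synonym entry = "nat \<times> nat \<times> bool"

abbreviation label :: "entry \<Rightarrow> nat" where "label x \<equiv> fst x"
abbreviation level :: "entry \<Rightarrow> nat" where "level x \<equiv> fst (snd x)"
abbreviation decorated :: "entry \<Rightarrow> bool" where "decorated x \<equiv> snd (snd x)"

definition diag_inv :: "entry \<Rightarrow> entry \<Rightarrow> bool" where
  "diag_inv x y \<longleftrightarrow> \<not> decorated x \<and>
    (level x = level y \<and> label x < label y \<or> level x = Suc (level y) \<and> label x > label y)"

text \<open>The Dyck condition, increasing labels in a column and contractibility of decorated steps
  are all conditions on neighbouring north steps; a rise by one level means the same column.\<close>

definition may_follow :: "entry \<Rightarrow> entry \<Rightarrow> bool" where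
  "may_follow x y \<longleftrightarrow> level y \<le> Suc (level x) \<and> (level y = Suc (level x) \<longrightarrow> label x < label y) \<and>
    (decorated y \<longrightarrow> level y < level x \<or> level y = level x \<and> label x < label y)"

abbreviation origin :: entry where "origin \<equiv> (0, 0, False)"

definition paths :: "entry set \<Rightarrow> entry list set" where
  "paths S = {l. distinct l \<and> set l = S \<and> successively may_follow (origin # l)}"

fun inv_count :: "entry list \<Rightarrow> nat" where
  "inv_count [] = 0"
| "inv_count (x # l) = length (filter (diag_inv x) l) + inv_count l"

text \<open>Decorations are subtracted in \<open>dinv\<close>, but at \<open>q = -1\<close> only the
  parity matters, so they may be added.\<close>

definition path_sign :: "entry list \<Rightarrow> 'a::comm_ring_1" where
  "path_sign l = (- 1) ^ (inv_count l + length (filter (\<lambda>x. decorated x) l))"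

text \<open>The order of insertion, and the entries whose number is the schedule number of \<open>e\<close>.\<close>

definition precedes :: "entry \<Rightarrow> entry \<Rightarrow> bool" where
  "precedes x e \<longleftrightarrow> (if decorated e
    then decorated x \<longrightarrow> level x < level e \<or> level x = level e \<and> label x > label e
    else \<not> decorated x \<and> (level x < level e \<or> level x = level e \<and> label x > label e))"

definition pivot :: "entry \<Rightarrow> entry \<Rightarrow> bool" where
  "pivot e x \<longleftrightarrow> \<not> decorated x \<and> (if decorated e then diag_inv x e else diag_inv e x)"

definition slot_ok :: "entry list \<Rightarrow> nat \<Rightarrow> entry \<Rightarrow> bool" where
  "slot_ok b i e \<longleftrightarrow> may_follow (b ! (i - 1)) e \<and> (i < length b \<longrightarrow> may_follow e (b ! i))"

lemma inv_count_insert: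
  "inv_count (p @ e # s) = inv_count (p @ s) +
    length (filter (\<lambda>x. diag_inv x e) p) + length (filter (diag_inv e) s)"
  by (induction p) auto

section \<open>Admissible slots of a new entry\<close>

text \<open>\<open>P\<close> stands for being a pivot. Behind a pivot \<open>y\<close> one more slot
  opens. If \<open>y\<close> is no pivot but \<open>e\<close> may follow it, the slot at the end
  moves across \<open>y\<close>, with the same number of pivots on its left. Otherwise nothing
  changes.\<close>

lemma slot_sum_step:
  fixes f :: "nat \<Rightarrow> 'a::comm_ring_1"
  assumes b: "b \<noteq> []"
    and IH: "(\<Sum>i = 1..length b. if slot_ok b i e then f (length (filter P (take i b))) else 0) =
      (\<Sum>j = 1..length (filter P b). f j)"
    and step: "P y \<Longrightarrow> may_follow e y \<and> may_follow y e"
      "\<not> P y \<Longrightarrow> may_follow y e \<Longrightarrow> may_follow (last b) e \<and> \<not> may_follow e y"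
      "\<not> P y \<Longrightarrow> \<not> may_follow y e \<Longrightarrow> may_follow e y"
  shows "(\<Sum>i = 1..length (b @ [y]). if slot_ok (b @ [y]) i e
        then f (length (filter P (take i (b @ [y])))) else 0) =
      (\<Sum>j = 1..length (filter P (b @ [y])). f j)"
proof -
  obtain m where m: "length b = Suc m" using b by (cases b) auto
  let ?s = "length (filter P b)"
  define A where "A = (\<Sum>i = 1..m. if slot_ok b i e then f (length (filter P (take i b))) else 0)"
  have lb: "b ! m = last b" using b m by (simp add: last_conv_nth)
  have tk: "take (Suc m) b = b" using m by simp
  have "slot_ok b (Suc m) e \<longleftrightarrow> may_follow (last b) e"
    using m lb by (simp add: slot_ok_def)
  then have IH': "A + (if may_follow (last b) e then f ?s else 0) = (\<Sum>j = 1..?s. f j)"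
    using IH by (simp add: A_def m tk split: if_splits)
  have "(\<Sum>i = 1..m. if slot_ok (b @ [y]) i e then f (length (filter P (take i (b @ [y])))) else 0) = A"
    unfolding A_def using m by (intro sum.cong) (auto simp: slot_ok_def nth_append)
  moreover have "slot_ok (b @ [y]) (Suc m) e \<longleftrightarrow> may_follow (last b) e \<and> may_follow e y"
    using m lb by (simp add: slot_ok_def nth_append)
  moreover have "slot_ok (b @ [y]) (Suc (Suc m)) e \<longleftrightarrow> may_follow y e"
    using m by (simp add: slot_ok_def nth_append)
  ultimately have "(\<Sum>i = 1..length (b @ [y]). if slot_ok (b @ [y]) i e
        then f (length (filter P (take i (b @ [y])))) else 0) =
      A + (if may_follow (last b) e \<and> may_follow e y then f ?s else 0) +
        (if may_follow y e then f (length (filter P (b @ [y]))) else 0)"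
    using m by simp
  also have "\<dots> = (\<Sum>j = 1..length (filter P (b @ [y])). f j)"
    using IH' step by (cases "P y"; cases "may_follow y e") auto
  finally show ?thesis .
qed

lemma may_follow_decorated:
  "decorated e \<Longrightarrow> may_follow y e \<longleftrightarrow>
    level e < level y \<or> level e = level y \<and> label y < label e"
  by (auto simp: may_follow_def)

lemma may_follow_undecorated:
  "\<not> decorated e \<Longrightarrow> may_follow y e \<longleftrightarrow>
    level e \<le> level y \<or> level e = Suc (level y) \<and> label y < label e"
  by (auto simp: may_follow_def)

text \<open>All entries present are undecorated and none lies above \<open>e\<close>, so the entry
  behind a slot never obstructs: the slots of an undecorated \<open>e\<close> are exactly those
  directly behind pivots.\<close>

lemma may_follow_undecorated_pivot:
  assumes "precedes y e" "\<not> decorated e"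
  shows "may_follow y e \<longleftrightarrow> pivot e y" "may_follow e y"
proof -
  have y: "\<not> decorated y" "level y < level e \<or> level y = level e \<and> label e < label y"
    using assms by (simp_all add: precedes_def)
  show "may_follow e y" using y(2) by (auto simp: may_follow_undecorated[OF y(1)])
  show "may_follow y e \<longleftrightarrow> pivot e y"
    unfolding may_follow_undecorated[OF assms(2)] using y assms(2)
    by (auto simp: pivot_def diag_inv_def)
qed

text \<open>A decorated \<open>e\<close> need not stand directly behind its pivot. A non-pivot
  \<open>y\<close> that it may follow is higher by at least two levels, or by one with a smaller
  label; so \<open>y\<close> may not follow \<open>e\<close>, and the slot before \<open>y\<close>
  is traded for the one behind it.\<close>

lemma may_follow_decorated_pivot:
  assumes y: "precedes y e" "label y \<noteq> label e" and e: "decorated e"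
  shows "pivot e y \<Longrightarrow> may_follow e y \<and> may_follow y e"
    and "\<not> pivot e y \<Longrightarrow> may_follow y e \<Longrightarrow> may_follow x y \<Longrightarrow> may_follow x e \<and> \<not> may_follow e y"
    and "\<not> pivot e y \<Longrightarrow> \<not> may_follow y e \<Longrightarrow> may_follow e y"
proof -
  have pv: "pivot e y \<longleftrightarrow> \<not> decorated y \<and>
      (level y = level e \<and> label y < label e \<or> level y = Suc (level e) \<and> label e < label y)"
    using e by (auto simp: pivot_def diag_inv_def)
  show "pivot e y \<Longrightarrow> may_follow e y \<and> may_follow y e"
    using pv by (auto simp: may_follow_decorated[OF e] may_follow_undecorated)
  show "may_follow e y" if "\<not> pivot e y" "\<not> may_follow y e"
  proof (cases "decorated y")
    case True
    then show ?thesis using y(1) e by (auto simp: precedes_def may_follow_decorated)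
  next
    case False
    then show ?thesis using that(2) by (auto simp: may_follow_decorated[OF e] may_follow_undecorated)
  qed
  show "may_follow x e \<and> \<not> may_follow e y"
    if np: "\<not> pivot e y" and ye: "may_follow y e" and xy: "may_follow x y"
  proof -
    have dy: "\<not> decorated y"
      using y(1) e ye by (auto simp: precedes_def may_follow_decorated)
    then have lev: "level e < level y" "level y = Suc (level e) \<Longrightarrow> label y < label e"
      using np ye y(2) unfolding pv may_follow_decorated[OF e] by auto
    then have "\<not> may_follow e y" by (auto simp: may_follow_undecorated[OF dy])
    moreover have "may_follow x e"
      using xy lev unfolding may_follow_decorated[OF e] may_follow_undecorated[OF dy] by force
    ultimately show ?thesis by simp
  qed
qed

lemma pivot_follow:
  assumes "precedes y e" "label y \<noteq> label e"
  shows "pivot e y \<Longrightarrow> may_follow e y \<and> may_follow y e"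
    and "\<not> pivot e y \<Longrightarrow> may_follow y e \<Longrightarrow> may_follow x y \<Longrightarrow> may_follow x e \<and> \<not> may_follow e y"
    and "\<not> pivot e y \<Longrightarrow> \<not> may_follow y e \<Longrightarrow> may_follow e y"
  using may_follow_decorated_pivot[OF assms] may_follow_undecorated_pivot[OF assms(1)]
  by (cases "decorated e"; blast)+

text \<open>There is exactly one admissible slot for \<open>e\<close> after each pivot and before the next one.\<close>

lemma slot_sum:
  fixes f :: "nat \<Rightarrow> 'a::comm_ring_1"
  assumes "successively may_follow (x0 # l)" "level x0 < level e" "\<not> decorated x0"
    and "\<And>x. x \<in> set l \<Longrightarrow> precedes x e \<and> label x \<noteq> label e"
  shows "(\<Sum>i = 1..length (x0 # l). if slot_ok (x0 # l) i e
        then f (length (filter (pivot e) (take i (x0 # l)))) else 0) =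
      (\<Sum>j = 1..length (filter (pivot e) (x0 # l)). f j)"
  using assms(1,4)
proof (induction l rule: rev_induct)
  case Nil
  have "may_follow x0 e \<longleftrightarrow> pivot e x0"
    using assms(2,3) by (auto simp: may_follow_def pivot_def diag_inv_def)
  then show ?case by (simp add: slot_ok_def)
next
  case (snoc y l)
  have s: "successively may_follow (x0 # l)" and ly: "may_follow (last (x0 # l)) y"
    using snoc.prems(1) successively_append_iff[of may_follow "x0 # l" "[y]"] by simp_all
  have y: "precedes y e" "label y \<noteq> label e" using snoc.prems(2) by auto
  have IH: "(\<Sum>i = 1..length (x0 # l). if slot_ok (x0 # l) i e
        then f (length (filter (pivot e) (take i (x0 # l)))) else 0) =
      (\<Sum>j = 1..length (filter (pivot e) (x0 # l)). f j)"
    using snoc.IH s snoc.prems(2) by simp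
  have "(\<Sum>i = 1..length ((x0 # l) @ [y]). if slot_ok ((x0 # l) @ [y]) i e
        then f (length (filter (pivot e) (take i ((x0 # l) @ [y])))) else 0) =
      (\<Sum>j = 1..length (filter (pivot e) ((x0 # l) @ [y])). f j)"
    using y ly pivot_follow[of y e]
    by (intro slot_sum_step[OF _ IH]) blast+
  then show ?case by (simp only: append_Cons)
qed

section \<open>Deleting and inserting the last entry\<close>

text \<open>Closing the gap left by \<open>e\<close> could merge two rises into a rise by two
  levels, or deprive a decorated \<open>y\<close> of its valley. The insertion order excludes
  both.\<close>

lemma may_follow_trans:
  assumes "may_follow x e" "may_follow e y" "precedes y e"
  shows "may_follow x y"
  using assms
  by (cases "decorated e"; cases "decorated y") (auto simp: may_follow_def precedes_def)

definition insert_at :: "entry \<Rightarrow> entry list \<Rightarrow> nat \<Rightarrow> entry list" where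
  "insert_at e l i = take (i - 1) l @ e # drop (i - 1) l"

lemma successively_insert_iff:
  assumes "p \<noteq> []"
  shows "successively R (p @ e # s) \<longleftrightarrow>
    successively R p \<and> R (last p) e \<and> (s \<noteq> [] \<longrightarrow> R e (hd s)) \<and> successively R s"
  using assms by (auto simp: successively_append_iff successively_Cons)

lemma slot_ok_iff:
  "slot_ok (origin # p @ s) (Suc (length p)) e \<longleftrightarrow>
    may_follow (last (origin # p)) e \<and> (s \<noteq> [] \<longrightarrow> may_follow e (hd s))"
proof -
  have "(origin # p @ s) ! length p = last (origin # p)"
    by (metis append_Cons last_conv_nth length_Cons diff_Suc_1 lessI list.distinct(1) nth_append)
  then show ?thesis by (cases s) (auto simp: slot_ok_def nth_append)
qed

lemma bij_insert_at:
  assumes "e \<notin> S" and "\<And>x. x \<in> S \<Longrightarrow> precedes x e"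
  shows "bij_betw (\<lambda>(l, i). insert_at e l i)
    (SIGMA l:paths S. {i \<in> {1..Suc (length l)}. slot_ok (origin # l) i e}) (paths (insert e S))"
proof (intro bij_betwI')
  fix u v
  assume "u \<in> (SIGMA l:paths S. {i \<in> {1..Suc (length l)}. slot_ok (origin # l) i e})"
    "v \<in> (SIGMA l:paths S. {i \<in> {1..Suc (length l)}. slot_ok (origin # l) i e})"
  then obtain l i l' i' where uv: "u = (l, i)" "v = (l', i')" "l \<in> paths S" "l' \<in> paths S"
    "1 \<le> i" "i \<le> Suc (length l)" "1 \<le> i'" "i' \<le> Suc (length l')" by auto
  have "l = l' \<and> i = i'" if "insert_at e l i = insert_at e l' i'"
  proof -
    have "e \<notin> set l" "e \<notin> set l'" using uv assms(1) by (auto simp: paths_def)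
    then have "e \<notin> set (take (i - 1) l)" "e \<notin> set (take (i' - 1) l')" by (meson in_set_takeD)+
    from append_eq_Cons_split[OF that[unfolded insert_at_def] this]
    have eq: "take (i - 1) l = take (i' - 1) l'" "drop (i - 1) l = drop (i' - 1) l'" by auto
    then have "l = l'" by (metis append_take_drop_id)
    moreover have "i - 1 = i' - 1"
      using arg_cong[OF eq(1), of length] uv by simp
    ultimately show ?thesis using uv by simp
  qed
  then show "((\<lambda>(l, i). insert_at e l i) u = (\<lambda>(l, i). insert_at e l i) v) = (u = v)"
    using uv by auto
next
  fix u assume "u \<in> (SIGMA l:paths S. {i \<in> {1..Suc (length l)}. slot_ok (origin # l) i e})"
  then obtain l i where u: "u = (l, i)" "l \<in> paths S" "1 \<le> i" "i \<le> Suc (length l)"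
    "slot_ok (origin # l) i e" by auto
  define p s where "p = take (i - 1) l" and "s = drop (i - 1) l"
  have l: "l = p @ s" and i: "i = Suc (length p)" using u by (auto simp: p_def s_def)
  have "successively may_follow (origin # p @ s)" using u(2) l by (simp add: paths_def)
  then have "successively may_follow (origin # p)" "successively may_follow s"
    using successively_append_iff[of may_follow "origin # p" s] by simp_all
  then have "successively may_follow ((origin # p) @ e # s)"
    using u(5) unfolding l i slot_ok_iff by (subst successively_insert_iff) auto
  moreover have "insert_at e l i = p @ e # s" by (simp add: insert_at_def p_def s_def)
  moreover have "distinct (p @ e # s)" "set (p @ e # s) = insert e S"
    using u(2) l assms(1) by (auto simp: paths_def)
  ultimately show "(\<lambda>(l, i). insert_at e l i) u \<in> paths (insert e S)"
    using u(1) by (simp add: paths_def)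
next
  fix l' assume l': "l' \<in> paths (insert e S)"
  then have "e \<in> set l'" by (simp add: paths_def)
  then obtain p s where ps: "l' = p @ e # s" using split_list[of e l'] by blast
  have "successively may_follow ((origin # p) @ e # s)" using l' ps by (simp add: paths_def)
  then have suc: "successively may_follow (origin # p)" "may_follow (last (origin # p)) e"
    "s \<noteq> [] \<longrightarrow> may_follow e (hd s)" "successively may_follow s"
    by (subst (asm) successively_insert_iff; simp)+
  have set: "distinct (p @ s)" "set (p @ s) = S" using l' ps assms(1) by (auto simp: paths_def)
  have "may_follow (last (origin # p)) (hd s)" if "s \<noteq> []"
  proof (rule may_follow_trans)
    show "may_follow (last (origin # p)) e" "may_follow e (hd s)" using suc that by simp_all
    show "precedes (hd s) e" using that set(2) by (intro assms(2)) (auto simp: hd_in_set)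
  qed
  then have "successively may_follow ((origin # p) @ s)"
    using suc by (subst successively_append_iff) (cases "s = []"; simp)
  then have "p @ s \<in> paths S" using set by (simp add: paths_def)
  moreover have "slot_ok (origin # p @ s) (Suc (length p)) e" using suc slot_ok_iff by blast
  moreover have "insert_at e (p @ s) (Suc (length p)) = l'" by (simp add: insert_at_def ps)
  ultimately show "\<exists>u\<in>SIGMA l:paths S. {i \<in> {1..Suc (length l)}. slot_ok (origin # l) i e}.
      l' = (\<lambda>(l, i). insert_at e l i) u"
    by (intro bexI[of _ "(p @ s, Suc (length p))"]) auto
qed

lemma alternating_sum_up: "(\<Sum>j = 1..s. (- 1) ^ Suc j) = (of_bool (odd s) :: 'a::comm_ring_1)"
  by (induction s) auto

lemma alternating_sum_down: "(\<Sum>j = 1..s. (- 1) ^ (s - j)) = (of_bool (odd s) :: 'a::comm_ring_1)"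
proof -
  have "(\<Sum>j = 1..s. (- 1) ^ (s - j)) = (\<Sum>j = 1..s. (- 1 :: 'a) ^ Suc j * (- 1) ^ Suc s)"
  proof (rule sum.cong)
    fix j assume "j \<in> {1..s}"
    then have "(- 1 :: 'a) ^ (s - j) = (- 1) ^ (s - j) * ((- 1) ^ j * (- 1) ^ j)"
      by (simp flip: power_mult_distrib)
    also have "\<dots> = (- 1) ^ (s - j + j) * (- 1) ^ j" by (simp only: power_add mult_ac)
    finally show "(- 1 :: 'a) ^ (s - j) = (- 1) ^ Suc j * (- 1) ^ Suc s"
      using \<open>j \<in> {1..s}\<close> by (simp add: mult_ac)
  qed simp
  also have "\<dots> = of_bool (odd s) * (- 1) ^ Suc s"
    unfolding sum_distrib_right[symmetric] alternating_sum_up by simp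
  also have "\<dots> = of_bool (odd s)" by (cases "odd s") auto
  finally show ?thesis .
qed

lemma finite_paths: "finite S \<Longrightarrow> finite (paths S)"
  by (rule finite_subset[OF _ finite_subset_distinct[of S]]) (auto simp: paths_def)

lemma length_filter_pivot:
  assumes "l \<in> paths S" "\<And>x. x \<in> S \<Longrightarrow> level x \<ge> 1"
  shows "length (filter (pivot e) (origin # l)) = card {x \<in> insert origin S. pivot e x}"
proof -
  have "distinct (origin # l)" using assms by (fastforce simp: paths_def)
  then have "length (filter (pivot e) (origin # l)) = card {x \<in> set (origin # l). pivot e x}"
    by (metis distinct_card distinct_filter set_filter)
  also have "set (origin # l) = insert origin S" using assms(1) by (simp add: paths_def)
  finally show ?thesis .
qed

text \<open>By \<open>slot_sum\<close> the slots are indexed by the number of pivots on their left,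
  each of \<open>1, ..., s\<close> once, and the sign alternates along this index.\<close>

lemma sum_insert_at:
  assumes l: "l \<in> paths S" and e: "level e \<ge> 1" and lev: "\<And>x. x \<in> S \<Longrightarrow> level x \<ge> 1"
    and pre: "\<And>x. x \<in> S \<Longrightarrow> precedes x e \<and> label x \<noteq> label e"
  shows "(\<Sum>i | i \<in> {1..Suc (length l)} \<and> slot_ok (origin # l) i e. path_sign (insert_at e l i)) =
    (of_bool (odd (card {x \<in> insert origin S. pivot e x})) * path_sign l :: 'a::comm_ring_1)"
proof -
  let ?c = "\<lambda>i. length (filter (pivot e) (take i (origin # l)))"
  let ?t = "length (filter (pivot e) (origin # l))"
  have S: "set l = S" using l by (simp add: paths_def)
  have suc: "successively may_follow (origin # l)" using l by (simp add: paths_def)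
  \<comment> \<open>With \<open>j\<close> pivots on its left, a decorated \<open>e\<close> gains
    \<open>j\<close> inversions and one decoration; an undecorated \<open>e\<close> gains an
    inversion with each of the \<open>?t - j\<close> pivots on its right, and none with entries on
    its left.\<close>
  define f :: "nat \<Rightarrow> 'a" where
    "f j = (if decorated e then (- 1) ^ Suc j else (- 1) ^ (?t - j))" for j
  have sgn: "path_sign (insert_at e l i) = f (?c i) * path_sign l" if "i \<in> {1..Suc (length l)}" for i
  proof -
    define p s where "p = take (i - 1) l" and "s = drop (i - 1) l"
    have ls: "l = p @ s" by (simp add: p_def s_def)
    have ti: "take i (origin # l) = origin # p" using that by (cases i) (auto simp: p_def)
    have ins: "insert_at e l i = p @ e # s" by (simp add: insert_at_def p_def s_def)
    have dec: "length (filter (\<lambda>x. decorated x) (p @ e # s)) =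
        length (filter (\<lambda>x. decorated x) l) + of_bool (decorated e)"
      by (simp add: ls)
    show ?thesis
    proof (cases "decorated e")
      case True
      have "\<not> pivot e origin" using e True by (simp add: pivot_def diag_inv_def)
      moreover have "filter (pivot e) p = filter (\<lambda>x. diag_inv x e) p"
        using True by (intro filter_cong) (auto simp: pivot_def diag_inv_def)
      moreover have "filter (diag_inv e) s = []" using True by (simp add: filter_empty_conv diag_inv_def)
      ultimately have "inv_count (p @ e # s) = inv_count l + ?c i"
        by (simp add: inv_count_insert ls[symmetric] ti)
      then show ?thesis
        unfolding path_sign_def ins dec f_def using True by (simp add: power_add mult_ac)
    next
      case False
      have pS: "precedes x e" "label x \<noteq> label e" if "x \<in> set p \<union> set s" for x
        using pre[of x] that S ls by auto
      have "filter (pivot e) s = filter (diag_inv e) s"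
        using False pS by (intro filter_cong) (auto simp: pivot_def precedes_def)
      then have "length (filter (diag_inv e) s) = ?t - ?c i"
        unfolding ti by (simp add: ls)
      moreover have "filter (\<lambda>x. diag_inv x e) p = []"
        using False pS by (fastforce simp: filter_empty_conv diag_inv_def precedes_def)
      ultimately have "inv_count (p @ e # s) = inv_count l + (?t - ?c i)"
        by (simp add: inv_count_insert ls[symmetric])
      then show ?thesis
        unfolding path_sign_def ins dec f_def using False by (simp add: power_add mult_ac)
    qed
  qed
  have "(\<Sum>i | i \<in> {1..Suc (length l)} \<and> slot_ok (origin # l) i e. path_sign (insert_at e l i)) =
      (\<Sum>i | i \<in> {1..Suc (length l)} \<and> slot_ok (origin # l) i e. f (?c i) * path_sign l)"
    by (intro sum.cong refl sgn) simp
  also have "\<dots> = (\<Sum>i | i \<in> {1..Suc (length l)} \<and> slot_ok (origin # l) i e. f (?c i)) * path_sign l"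
    by (simp only: sum_distrib_right)
  also have "(\<Sum>i | i \<in> {1..Suc (length l)} \<and> slot_ok (origin # l) i e. f (?c i)) =
      (\<Sum>i = 1..Suc (length l). if slot_ok (origin # l) i e then f (?c i) else 0)"
    by (rule sum.inter_filter) simp
  also have "\<dots> = (\<Sum>j = 1..?t. f j)"
    using slot_sum[OF suc, of e f] e pre S by simp
  also have "\<dots> = of_bool (odd ?t)"
  proof (cases "decorated e")
    case True
    show ?thesis unfolding f_def using alternating_sum_up[of ?t] by (simp only: True if_True)
  next
    case False
    show ?thesis unfolding f_def using alternating_sum_down[of ?t] by (simp only: False if_False)
  qed
  also have "?t = card {x \<in> insert origin S. pivot e x}"
    by (rule length_filter_pivot[OF l lev])
  finally show ?thesis .
qed

text \<open>The candidates are the decorated entries, or all entries if none is decorated; the last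
  one is on their highest level and has the smallest label there.\<close>

lemma ex_last_entry:
  assumes "finite S" "S \<noteq> {}" "inj_on label S"
  obtains e where "e \<in> S" "\<And>x. x \<in> S - {e} \<Longrightarrow> precedes x e"
proof -
  define T where "T = (if \<exists>x\<in>S. decorated x then {x \<in> S. decorated x} else S)"
  have "finite T" "T \<subseteq> S" using assms(1) by (simp_all add: T_def)
  moreover have "T \<noteq> {}"
  proof (cases "\<exists>x\<in>S. decorated x")
    case True
    then obtain x where "x \<in> S" "decorated x" by blast
    then have "x \<in> T" unfolding T_def by auto
    then show ?thesis by blast
  next
    case False
    then show ?thesis unfolding T_def using assms(2) by (simp only: if_False not_False_eq_True)
  qed
  ultimately have T: "finite T" "T \<noteq> {}" "T \<subseteq> S" by simp_all
  define U where "U = {x \<in> T. level x = Max (level ` T)}"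
  have "Max (level ` T) \<in> level ` T" using T by (intro Max_in) simp_all
  then obtain u where "Max (level ` T) = level u" "u \<in> T" by (rule imageE)
  then have "u \<in> U" by (simp add: U_def)
  moreover have "finite U" using T(1) by (simp add: U_def)
  ultimately have U: "finite U" "U \<noteq> {}" by blast+
  have "Min (label ` U) \<in> label ` U" using U by (intro Min_in) simp_all
  then obtain e where e: "Min (label ` U) = label e" "e \<in> U" by (rule imageE)
  have max: "level x \<le> level e" if "x \<in> T" for x
    using e(2) that T by (simp add: U_def)
  have min: "label e < label x" if "x \<in> T" "level x = level e" "x \<noteq> e" for x
  proof -
    have "x \<in> U" using that e(2) by (simp add: U_def)
    then have "label e \<le> label x" using e(1) U by (metis Min_le finite_imageI imageI)
    moreover have "label e \<noteq> label x"
      using inj_onD[OF assms(3), of e x] that e(2) T(3) by (auto simp: U_def)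
    ultimately show ?thesis by simp
  qed
  have eT: "e \<in> T" using e(2) by (simp add: U_def)
  show ?thesis
  proof (rule that)
    show "e \<in> S" using eT T by blast
    fix x assume x: "x \<in> S - {e}"
    have "level x < level e \<or> level x = level e \<and> label x > label e" if "x \<in> T"
      using max[OF that] min[OF that] x by force
    then show "precedes x e"
      using eT x by (auto simp: precedes_def T_def split: if_splits)
  qed
qed

text \<open>The entry inserted last is not a pivot of any earlier one. The schedule numbers can
  therefore be computed in the full set instead of at the time of insertion, and each insertion
  contributes an independent factor.\<close>

lemma paths_sign_sum:
  assumes "finite S" "inj_on label S" "\<And>x. x \<in> S \<Longrightarrow> level x \<ge> 1"
  shows "sum path_sign (paths S) =
    (of_bool (\<forall>e\<in>S. odd (card {x \<in> insert origin S. pivot e x})) :: 'a::comm_ring_1)"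
  using assms
proof (induction "card S" arbitrary: S)
  case 0
  then have "S = {}" by simp
  moreover have "paths {} = {[]}" by (auto simp: paths_def)
  ultimately show ?case by (simp add: path_sign_def)
next
  case (Suc n)
  then have "S \<noteq> {}" by auto
  then obtain e where e: "e \<in> S" "\<And>x. x \<in> S - {e} \<Longrightarrow> precedes x e"
    using ex_last_entry Suc.prems by blast
  define R where "R = S - {e}"
  have S: "S = insert e R" "e \<notin> R" using e(1) by (auto simp: R_def)
  have R: "finite R" "inj_on label R" "\<And>x. x \<in> R \<Longrightarrow> level x \<ge> 1" "n = card R"
    using Suc.prems Suc.hyps(2) S by (auto simp: inj_on_insert)
  have pre: "precedes x e \<and> label x \<noteq> label e" if "x \<in> R" for x
    using e that Suc.prems(2) by (auto simp: R_def dest: inj_onD)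
  let ?p = "\<lambda>S e. card {x \<in> insert origin S. pivot e x}"
  have "\<not> pivot e e" by (auto simp: pivot_def diag_inv_def)
  then have pe: "{x \<in> insert origin R. pivot e x} = {x \<in> insert origin S. pivot e x}"
    using S by auto
  have pR: "{y \<in> insert origin R. pivot x y} = {y \<in> insert origin S. pivot x y}" if "x \<in> R" for x
  proof -
    have "\<not> pivot x e"
      using pre[OF that] by (cases "decorated e") (auto simp: pivot_def diag_inv_def precedes_def)
    then show ?thesis using S by auto
  qed
  have "sum path_sign (paths S) = (\<Sum>(l, i)\<in>(SIGMA l:paths R. {i \<in> {1..Suc (length l)}.
      slot_ok (origin # l) i e}). path_sign (insert_at e l i) :: 'a)"
    unfolding S(1) using pre
    by (subst sum.reindex_bij_betw[OF bij_insert_at[OF S(2)], symmetric]) (auto simp: case_prod_unfold)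
  also have "\<dots> = (\<Sum>l\<in>paths R. \<Sum>i | i \<in> {1..Suc (length l)} \<and> slot_ok (origin # l) i e.
      path_sign (insert_at e l i))"
    using finite_paths[OF R(1)] by (intro sum.Sigma[symmetric]) auto
  also have "\<dots> = (\<Sum>l\<in>paths R. of_bool (odd (?p R e)) * path_sign l)"
    using Suc.prems(3)[OF e(1)] R(3) pre by (intro sum.cong refl sum_insert_at)
  also have "\<dots> = of_bool (odd (?p R e)) * of_bool (\<forall>x\<in>R. odd (?p R x))"
    using Suc.hyps(1)[OF R(4,1,2,3)] by (simp add: sum_distrib_left[symmetric])
  also have "\<dots> = of_bool (\<forall>x\<in>S. odd (?p S x))"
    using pe pR by (simp add: S(1) flip: of_bool_conj)
  finally show ?case .
qed

section \<open>Grouping paths by the word of their labels\<close>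

fun entries :: "nat \<Rightarrow> (nat \<times> bool) list \<Rightarrow> entry list" where
  "entries a [] = []"
| "entries a (x # w) = (a, Suc (fst x), snd x) # entries (Suc a) w"

lemma entries_append: "entries a (p @ s) = entries a p @ entries (a + length p) s"
  by (induction p arbitrary: a) auto

lemma entries_conv_map:
  "entries a w = map (\<lambda>i. (a + i, Suc (fst (w ! i)), snd (w ! i))) [0..<length w]"
proof (induction w arbitrary: a)
  case (Cons x w)
  show ?case
    by (simp add: Cons upt_conv_Cons map_Suc_upt[symmetric] del: upt_Suc)
qed simp

lemma map_label_entries: "map fst (entries a w) = [a..<a + length w]"
  by (rule nth_equalityI) (auto simp: entries_conv_map)

lemma level_entries: "x \<in> set (entries a w) \<Longrightarrow> level x \<ge> 1"
  by (induction w arbitrary: a) auto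

lemma filter_pivot_before:
  assumes "a + length p \<le> c"
  shows "length (filter (pivot (c, Suc d, b)) (entries a p)) = below_count p (slot (d, b))"
  using assms
proof (induction p arbitrary: a)
  case (Cons x p)
  have "pivot (c, Suc d, b) (a, Suc (fst x), snd x) \<longleftrightarrow> slot (d, b) = Suc (fst x) \<and> \<not> snd x"
    using Cons.prems by (cases b) (auto simp: pivot_def diag_inv_def)
  then show ?case using Cons by simp
qed simp

lemma filter_pivot_after:
  assumes "c < a"
  shows "length (filter (pivot (c, Suc d, b)) (entries a s)) = count_list s (slot (d, b), False)"
  using assms
proof (induction s arbitrary: a)
  case (Cons x s)
  have "pivot (c, Suc d, b) (a, Suc (fst x), snd x) \<longleftrightarrow> x = (slot (d, b), False)"
    using Cons.prems by (cases b; cases x) (auto simp: pivot_def diag_inv_def)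
  then show ?case using Cons by simp
qed simp

lemma distinct_entries: "distinct (entries a w)"
  by (rule distinct_map[THEN iffD1, THEN conjunct1, of fst]) (simp add: map_label_entries)

text \<open>Positions in the word are labels, so smaller labels stand to the left. The sentinel
  \<open>origin\<close> is a pivot exactly for slot 0 and is thus the virtual label in the schedule
  number.\<close>

lemma card_pivot_entries:
  assumes "w = p @ (d, b) # s"
  shows "card {x \<in> insert origin (set (entries 1 w)). pivot (Suc (length p), Suc d, b) x} =
    of_bool (slot (d, b) = 0) + below_count p (slot (d, b)) + count_list s (slot (d, b), False)"
proof -
  let ?e = "(Suc (length p), Suc d, b)"
  have o: "origin \<notin> set (entries 1 w)" using level_entries by force
  have "card {x \<in> insert origin (set (entries 1 w)). pivot ?e x} =
      card (set (filter (pivot ?e) (origin # entries 1 w)))"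
    by (rule arg_cong[of _ _ card]) auto
  also have "\<dots> = length (filter (pivot ?e) (origin # entries 1 w))"
    using o distinct_entries by (intro distinct_card distinct_filter) simp
  also have "\<dots> = of_bool (pivot ?e origin) + (length (filter (pivot ?e) (entries 1 p)) +
      (of_bool (pivot ?e ?e) + length (filter (pivot ?e) (entries (Suc (Suc (length p))) s))))"
    by (simp add: assms entries_append)
  also have "pivot ?e ?e \<longleftrightarrow> False" by (simp add: pivot_def diag_inv_def)
  also have "pivot ?e origin \<longleftrightarrow> slot (d, b) = 0"
    by (cases b) (auto simp: pivot_def diag_inv_def)
  also have "length (filter (pivot ?e) (entries 1 p)) = below_count p (slot (d, b))"
    by (rule filter_pivot_before) simp
  also have "length (filter (pivot ?e) (entries (Suc (Suc (length p))) s)) =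
      count_list s (slot (d, b), False)"
    by (rule filter_pivot_after) simp
  finally show ?thesis by simp
qed

lemma odd_pivots_iff_odd_word:
  "(\<forall>e\<in>set (entries 1 w). odd (card {x \<in> insert origin (set (entries 1 w)). pivot e x}))
    \<longleftrightarrow> odd_word w"
proof
  assume L: "\<forall>e\<in>set (entries 1 w). odd (card {x \<in> insert origin (set (entries 1 w)). pivot e x})"
  show "odd_word w"
    unfolding odd_word_def
  proof (rule odd_blockI)
    fix p x s assume w: "w = p @ x # s"
    then have "(Suc (length p), Suc (fst x), snd x) \<in> set (entries 1 w)"
      by (simp add: entries_append)
    with L have "odd (card {y \<in> insert origin (set (entries 1 w)).
        pivot (Suc (length p), Suc (fst x), snd x) y})" by blast
    then show "odd (of_bool (slot x = 0) + below_count p (slot x) + count_list s (slot x, False))"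
      by (subst (asm) card_pivot_entries[of w p "fst x" "snd x" s]) (use w in simp_all)
  qed
next
  assume R: "odd_word w"
  show "\<forall>e\<in>set (entries 1 w). odd (card {x \<in> insert origin (set (entries 1 w)). pivot e x})"
  proof
    fix e assume "e \<in> set (entries 1 w)"
    then obtain i where i: "i < length w" "e = (Suc i, Suc (fst (w ! i)), snd (w ! i))"
      by (auto simp: entries_conv_map)
    have w: "w = take i w @ (fst (w ! i), snd (w ! i)) # drop (Suc i) w"
      using i(1) by (simp add: id_take_nth_drop[symmetric])
    have "e = (Suc (length (take i w)), Suc (fst (w ! i)), snd (w ! i))" using i by simp
    then show "odd (card {x \<in> insert origin (set (entries 1 w)). pivot e x})"
      using odd_blockD[OF R[unfolded odd_word_def] w] card_pivot_entries[OF w]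
      by (simp only: not_False_eq_True)
  qed
qed

definition labelled_paths :: "nat \<Rightarrow> entry list set" where
  "labelled_paths n = {l. distinct (map fst l) \<and> fst ` set l = {1..n} \<and>
    (\<forall>x\<in>set l. level x \<ge> 1) \<and> successively may_follow (origin # l)}"

definition path_weight :: "'a::comm_ring_1 \<Rightarrow> 'a \<Rightarrow> entry list \<Rightarrow> 'a" where
  "path_weight t z l = path_sign l *
    (t ^ (\<Sum>x\<in>set l. level x - 1) * z ^ card {x \<in> set l. decorated x})"

lemma level_le_Suc_index:
  assumes "successively may_follow (x0 # l)" "i < length l"
  shows "level (l ! i) \<le> level x0 + Suc i"
  using assms
proof (induction l arbitrary: x0 i)
  case (Cons y l)
  have y: "level y \<le> Suc (level x0)" "successively may_follow (y # l)"
    using Cons.prems(1) by (auto simp: may_follow_def)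
  show ?case
  proof (cases i)
    case (Suc j)
    then show ?thesis using Cons.IH[OF y(2), of j] Cons.prems(2) y(1) by simp
  qed (use y in simp)
qed simp

lemma labelled_paths_length: "l \<in> labelled_paths n \<Longrightarrow> length l = n"
  unfolding labelled_paths_def using distinct_card[of "map fst l"] by simp

lemma labelled_paths_level_le:
  assumes "l \<in> labelled_paths n" "x \<in> set l"
  shows "level x \<le> n"
proof -
  obtain i where "i < length l" "x = l ! i" using assms(2) by (metis in_set_conv_nth)
  then show ?thesis
    using level_le_Suc_index[of origin l i] assms(1) labelled_paths_length[OF assms(1)]
    by (simp add: labelled_paths_def)
qed

text \<open>A finite index set for the fibres: no area in a path of size \<open>n\<close> exceeds
  \<open>n - 1\<close>.\<close>

definition bounded_words :: "nat \<Rightarrow> (nat \<times> bool) list set" where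
  "bounded_words n = {w. set w \<subseteq> {..<n} \<times> UNIV \<and> length w = n}"

lemma finite_bounded_words: "finite (bounded_words n)"
  unfolding bounded_words_def by (intro finite_lists_length_eq finite_cartesian_product) simp_all

lemma entries_paths_labelled:
  assumes "l \<in> paths (set (entries 1 w))"
  shows "l \<in> labelled_paths (length w)"
proof -
  have l: "distinct l" "set l = set (entries 1 w)" "successively may_follow (origin # l)"
    using assms by (simp_all add: paths_def)
  have "fst ` set (entries 1 w) = set (map fst (entries 1 w))" by simp
  also have "\<dots> = {1..length w}" unfolding map_label_entries by auto
  finally have im: "fst ` set (entries 1 w) = {1..length w}" .
  have "inj_on fst (set (entries 1 w))"
    using map_label_entries[of 1 w] distinct_upt by (metis distinct_map)
  then show ?thesis
    using l im level_entries unfolding labelled_paths_def by (auto simp: distinct_map)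
qed

text \<open>A path determines the diagonal and decoration of each label, hence a word; the fibre
  over a word consists of the admissible orders of its entries.\<close>

lemma labelled_paths_eq_UN:
  "labelled_paths n = (\<Union>w\<in>bounded_words n. paths (set (entries 1 w)))"
proof (intro equalityI subsetI)
  fix l assume l: "l \<in> labelled_paths n"
  have im: "fst ` set l = {1..n}" and inj: "inj_on fst (set l)" and d: "distinct l"
    using l by (auto simp: labelled_paths_def distinct_map)
  have "\<forall>i\<in>{1..n}. \<exists>x. x \<in> set l \<and> fst x = i" using im by (metis imageE)
  then obtain f where f: "\<And>i. i \<in> {1..n} \<Longrightarrow> f i \<in> set l \<and> fst (f i) = i" by metis
  define w where "w = map (\<lambda>i. (level (f (Suc i)) - 1, decorated (f (Suc i)))) [0..<n]"
  have len: "length w = n" by (simp add: w_def)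
  have f_eq: "(Suc i, Suc (fst (w ! i)), snd (w ! i)) = f (Suc i)" if "i < n" for i
  proof -
    have "f (Suc i) \<in> set l" "fst (f (Suc i)) = Suc i" using f[of "Suc i"] that by auto
    moreover have "level (f (Suc i)) \<ge> 1" using l calculation(1) by (auto simp: labelled_paths_def)
    ultimately show ?thesis using that by (simp add: w_def prod_eq_iff)
  qed
  have "set (entries 1 w) = (\<lambda>i. f (Suc i)) ` {0..<n}"
    unfolding entries_conv_map set_map set_upt len
    by (intro image_cong refl) (use f_eq in simp)
  also have "\<dots> = f ` {1..n}"
  proof -
    have "{1..n} = Suc ` {0..<n}" by (simp add: image_Suc_atLeastLessThan atLeastLessThanSuc_atLeastAtMost)
    then show ?thesis by (simp only: image_image)
  qed
  also have "\<dots> = set l"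
  proof (intro equalityI subsetI)
    fix x assume "x \<in> set l"
    then have "fst x \<in> {1..n}" using im by blast
    with f have "f (fst x) = x" using inj \<open>x \<in> set l\<close> by (metis inj_onD)
    then show "x \<in> f ` {1..n}" using \<open>fst x \<in> {1..n}\<close> by (metis imageI)
  qed (use f in auto)
  finally have "l \<in> paths (set (entries 1 w))"
    using l d by (simp add: paths_def labelled_paths_def)
  moreover have "w \<in> bounded_words n"
  proof -
    have "level (f (Suc i)) - 1 < n" if "i < n" for i
      using labelled_paths_level_le[OF l, of "f (Suc i)"] f[of "Suc i"] that by auto
    then show ?thesis by (auto simp: bounded_words_def w_def)
  qed
  ultimately show "l \<in> (\<Union>w\<in>bounded_words n. paths (set (entries 1 w)))" by blast
next
  fix l assume "l \<in> (\<Union>w\<in>bounded_words n. paths (set (entries 1 w)))"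
  then show "l \<in> labelled_paths n" using entries_paths_labelled by (auto simp: bounded_words_def)
qed

lemma entries_inject:
  assumes "set (entries 1 w) = set (entries 1 w')" "length w = length w'"
  shows "w = w'"
proof (rule nth_equalityI[OF assms(2)])
  fix i assume i: "i < length w"
  then have "(Suc i, Suc (fst (w ! i)), snd (w ! i)) \<in> set (entries 1 w')"
    unfolding assms(1)[symmetric] by (auto simp: entries_conv_map)
  then show "w ! i = w' ! i" by (auto simp: entries_conv_map prod_eq_iff)
qed

lemma word_weight_entries:
  "t ^ (\<Sum>x\<in>set (entries a w). level x - 1) * z ^ card {x \<in> set (entries a w). decorated x} =
    word_weight t z w"
proof -
  have "(\<Sum>x\<in>set (entries a w). level x - 1) = sum_list (map (\<lambda>x. level x - 1) (entries a w))"
    by (simp add: sum_list_distinct_conv_sum_set distinct_entries)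
  also have "\<dots> = sum_list (map fst w)" by (induction w arbitrary: a) auto
  finally have 1: "(\<Sum>x\<in>set (entries a w). level x - 1) = sum_list (map fst w)" .
  have "card {x \<in> set (entries a w). decorated x} = length (filter (\<lambda>x. decorated x) (entries a w))"
    using distinct_card[OF distinct_filter[OF distinct_entries]] by (metis set_filter)
  also have "\<dots> = length (filter snd w)" by (induction w arbitrary: a) auto
  finally show ?thesis unfolding 1 word_weight_def by simp
qed

lemma labelled_paths_sum:
  fixes t z :: "'a::comm_ring_1"
  shows "sum (path_weight t z) (labelled_paths n) = sum (word_weight t z) (odd_words n)"
proof -
  have inj: "inj_on fst (set (entries 1 w))" for w
    using map_label_entries[of 1 w] distinct_upt by (metis distinct_map)
  have sgn: "sum path_sign (paths (set (entries 1 w))) = (of_bool (odd_word w) :: 'a)" for w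
  proof -
    have "sum path_sign (paths (set (entries 1 w))) = (of_bool (\<forall>e\<in>set (entries 1 w).
        odd (card {x \<in> insert origin (set (entries 1 w)). pivot e x})) :: 'a)"
      by (rule paths_sign_sum) (use inj level_entries in \<open>simp_all only: finite_set\<close>)
    then show ?thesis by (simp only: odd_pivots_iff_odd_word)
  qed
  have disj: "paths (set (entries 1 w)) \<inter> paths (set (entries 1 w')) = {}"
    if "w \<in> bounded_words n" "w' \<in> bounded_words n" "w \<noteq> w'" for w w'
  proof -
    have "set (entries 1 w) \<noteq> set (entries 1 w')"
      using entries_inject[of w w'] that by (auto simp: bounded_words_def)
    then show ?thesis by (auto simp: paths_def)
  qed
  have "sum (path_weight t z) (labelled_paths n) =
      (\<Sum>w\<in>bounded_words n. sum (path_weight t z) (paths (set (entries 1 w))))"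
    unfolding labelled_paths_eq_UN
    using finite_bounded_words disj finite_paths by (intro sum.UNION_disjoint) auto
  also have "\<dots> = (\<Sum>w\<in>bounded_words n. of_bool (odd_word w) * word_weight t z w)"
  proof (rule sum.cong[OF refl])
    fix w
    have "sum (path_weight t z) (paths (set (entries 1 w))) =
        (\<Sum>l\<in>paths (set (entries 1 w)). path_sign l * word_weight t z w)"
    proof (rule sum.cong[OF refl])
      fix l assume "l \<in> paths (set (entries 1 w))"
      then have "set l = set (entries 1 w)" by (simp only: paths_def mem_Collect_eq)
      then show "path_weight t z l = path_sign l * word_weight t z w"
        by (simp only: path_weight_def word_weight_entries)
    qed
    then show "sum (path_weight t z) (paths (set (entries 1 w))) =
        of_bool (odd_word w) * word_weight t z w"
      by (simp only: sgn sum_distrib_right[symmetric])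
  qed
  also have "\<dots> = (\<Sum>w\<in>bounded_words n. if odd_word w then word_weight t z w else 0)"
    by (rule sum.cong) auto
  also have "\<dots> = sum (word_weight t z) {w \<in> bounded_words n. odd_word w}"
    by (rule sum.inter_filter[symmetric, OF finite_bounded_words])
  also have "{w \<in> bounded_words n. odd_word w} = odd_words n"
  proof (intro equalityI subsetI)
    fix w assume w: "w \<in> odd_words n"
    \<comment> \<open>A nonzero sign sum means that the odd word has at least one path, and any such
      path bounds the diagonals.\<close>
    then have "sum path_sign (paths (set (entries 1 w))) = (1::'a)"
      using sgn by (simp add: odd_words_def)
    then obtain l where l: "l \<in> paths (set (entries 1 w))" by fastforce
    then have "l \<in> labelled_paths n" using entries_paths_labelled w by (auto simp: odd_words_def)
    then have lev: "level x \<le> n" if "x \<in> set (entries 1 w)" for x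
      using labelled_paths_level_le l that by (auto simp: paths_def)
    have "fst (w ! i) < n" if "i < n" for i
      using lev[of "(Suc i, Suc (fst (w ! i)), snd (w ! i))"] that w
      by (auto simp: entries_conv_map odd_words_def)
    then have "set w \<subseteq> {..<n} \<times> UNIV"
      using w by (fastforce simp: odd_words_def in_set_conv_nth)
    then show "w \<in> {w \<in> bounded_words n. odd_word w}"
      using w by (simp add: odd_words_def bounded_words_def)
  qed (simp add: odd_words_def bounded_words_def)
  finally show ?thesis .
qed

section \<open>Dyck paths as lists of entries\<close>

lemma length_north_columns: "length (north_columns e \<pi>) = count_list \<pi> North"
  by (induction e \<pi> rule: north_columns.induct) auto

lemma north_columns_ge: "x \<in> set (north_columns e \<pi>) \<Longrightarrow> e \<le> x"
  by (induction e \<pi> rule: north_columns.induct) auto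

lemma sorted_north_columns: "sorted (north_columns e \<pi>)"
  by (induction e \<pi> rule: north_columns.induct) (auto dest: north_columns_ge)

text \<open>The columns do not record the east steps behind the last north step; the second
  assumption fixes their number.\<close>

lemma north_columns_inject:
  assumes "north_columns e \<pi> = north_columns e \<pi>'" "count_list \<pi> East = count_list \<pi>' East"
  shows "\<pi> = \<pi>'"
  using assms
proof (induction e \<pi> arbitrary: \<pi>' rule: north_columns.induct)
  case (1 e)
  then have "count_list \<pi>' North = 0" "count_list \<pi>' East = 0"
    using length_north_columns[of e \<pi>'] by auto
  then have "x \<notin> set \<pi>'" for x by (cases x) (auto simp: count_list_0_iff)
  then show ?case by (cases \<pi>') auto
next
  case (2 e \<pi>)
  show ?case
  proof (cases \<pi>')
    case (Cons s \<pi>'')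
    then show ?thesis
    proof (cases s)
      case East
      have "e \<in> set (north_columns (e + 1) \<pi>'')" using 2(2) Cons East by (metis list.set_intros(1)
            north_columns.simps(2,3))
      then show ?thesis using north_columns_ge by fastforce
    qed (use 2 Cons in auto)
  qed (use 2 in auto)
next
  case (3 e \<pi>)
  show ?case
  proof (cases \<pi>')
    case (Cons s \<pi>'')
    then show ?thesis
    proof (cases s)
      case North
      have "e \<in> set (north_columns (e + 1) \<pi>)" using 3(2) Cons North by (metis list.set_intros(1)
            north_columns.simps(2,3))
      then show ?thesis using north_columns_ge by fastforce
    qed (use 3 Cons in auto)
  qed (use 3 in auto)
qed

lemma all_nat_split: "(\<forall>k. P k) \<longleftrightarrow> P 0 \<and> (\<forall>k. P (Suc k))"
  by (metis not0_implies_Suc)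

text \<open>It is enough to look at the north steps and the end: an east step goes at most to the
  column of the next north step, or to that of the endpoint if there is none. The starting point
  \<open>(e, y)\<close> is free for the induction.\<close>

lemma prefix_counts_iff:
  "(\<forall>k. e + count_list (take k \<pi>) East \<le> y + count_list (take k \<pi>) North) \<longleftrightarrow>
    e \<le> y \<and> (\<forall>i<length (north_columns e \<pi>). north_columns e \<pi> ! i \<le> y + i) \<and>
    e + count_list \<pi> East \<le> y + count_list \<pi> North"
proof (induction \<pi> arbitrary: e y)
  case (Cons s \<pi>)
  show ?case
  proof (cases s)
    case North
    have "(\<forall>k. e + count_list (take k (s # \<pi>)) East \<le> y + count_list (take k (s # \<pi>)) North) \<longleftrightarrow>
        e \<le> y \<and> (\<forall>k. e + count_list (take k \<pi>) East \<le> Suc y + count_list (take k \<pi>) North)"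
      by (subst all_nat_split) (simp add: North)
    then show ?thesis unfolding Cons.IH by (auto simp: North All_less_Suc2)
  next
    case East
    have "(\<forall>k. e + count_list (take k (s # \<pi>)) East \<le> y + count_list (take k (s # \<pi>)) North) \<longleftrightarrow>
        e \<le> y \<and> (\<forall>k. Suc e + count_list (take k \<pi>) East \<le> y + count_list (take k \<pi>) North)"
      by (subst all_nat_split) (simp add: East)
    moreover have "Suc e \<le> y"
      if "\<forall>i<length (north_columns (Suc e) \<pi>). north_columns (Suc e) \<pi> ! i \<le> y + i"
        "Suc e + count_list \<pi> East \<le> y + count_list \<pi> North"
    proof (cases "north_columns (Suc e) \<pi>")
      case Nil
      then show ?thesis using that(2) length_north_columns[of "Suc e" \<pi>] by simp
    next
      case (Cons x xs)
      then show ?thesis using that(1) north_columns_ge[of x "Suc e" \<pi>] by force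
    qed
    ultimately show ?thesis unfolding Cons.IH by (auto simp: East)
  qed
qed auto

lemma ex_north_columns:
  assumes "sorted xs" "\<forall>x\<in>set xs. e \<le> x \<and> x \<le> m" "e \<le> m"
  shows "\<exists>\<pi>. north_columns e \<pi> = xs \<and> e + count_list \<pi> East = m"
proof -
  have easts: "north_columns e (replicate j East @ \<pi>) = north_columns (e + j) \<pi>"
    "count_list (replicate j East) East = j" for e j \<pi>
    by (induction j arbitrary: e) simp_all
  show ?thesis using assms
  proof (induction xs arbitrary: e)
    case Nil
    then show ?case using easts(1)[of e "m - e" "[]"] easts(2)[of "m - e"]
      by (intro exI[of _ "replicate (m - e) East"]) simp
  next
    case (Cons x xs)
    then obtain \<pi> where "north_columns x \<pi> = xs" "x + count_list \<pi> East = m" by force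
    then show ?case using Cons.prems easts
      by (intro exI[of _ "replicate (x - e) East @ North # \<pi>"]) simp
  qed
qed

lemma dyck_path_iff:
  "dyck_path n \<pi> \<longleftrightarrow> length (north_columns 0 \<pi>) = n \<and> count_list \<pi> East = n \<and>
    (\<forall>i<n. north_columns 0 \<pi> ! i \<le> i)"
  unfolding dyck_path_def length_north_columns
  using prefix_counts_iff[of 0 \<pi> 0] by (auto simp: length_north_columns)

section \<open>The bijection with decorated labelled Dyck paths\<close>

definition path_entries :: "nat \<Rightarrow> decorated_path \<Rightarrow> entry list" where
  "path_entries n = (\<lambda>(\<pi>, w, dv). map (\<lambda>i. (w i, Suc (area_word \<pi> i), i \<in> dv)) [1..<Suc n])"

lemma successively_Cons_nth:
  "successively R (x # l) \<longleftrightarrow> (l \<noteq> [] \<longrightarrow> R x (l ! 0)) \<and> (\<forall>i. Suc i < length l \<longrightarrow> R (l ! i) (l ! Suc i))"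
  by (auto simp: successively_Cons successively_conv_nth[of R l] hd_conv_nth)

lemma column_mono:
  assumes "dyck_path n \<pi>" "1 \<le> i" "i \<le> j" "j \<le> n"
  shows "column \<pi> i \<le> column \<pi> j"
  using assms sorted_nth_mono[OF sorted_north_columns, of "i - 1" "j - 1" 0 \<pi>]
  by (simp add: column_def dyck_path_iff)

lemma column_area:
  assumes "dyck_path n \<pi>" "1 \<le> i" "i \<le> n"
  shows "column \<pi> i + area_word \<pi> i = i - 1"
proof -
  have "north_columns 0 \<pi> ! (i - 1) \<le> i - 1" using assms by (auto simp: dyck_path_iff)
  then show ?thesis by (simp add: area_word_def column_def)
qed

lemma path_entries_labelled:
  assumes "P \<in> stLD n k"
  shows "path_entries n P \<in> labelled_paths n"
proof -
  obtain \<pi> w dv where P: "P = (\<pi>, w, dv)" by (cases P) auto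
  have d: "dyck_path n \<pi>" and lab: "st_labelling n \<pi> w"
    and dv: "dv \<subseteq> contractible_valleys n \<pi> w"
    using assms by (simp_all add: P stLD_def)
  have w: "w permutes {1..n}" using lab by (simp add: st_labelling_def)
  let ?f = "\<lambda>i. (w i, Suc (area_word \<pi> i), i \<in> dv)"
  have l: "path_entries n P = map ?f [1..<Suc n]" by (simp add: path_entries_def P)
  have len: "length (path_entries n P) = n" by (simp add: l)
  have nth: "path_entries n P ! i = ?f (Suc i)" if "i < n" for i
    using that by (simp add: l del: upt_Suc)
  have "map fst (path_entries n P) = map w [1..<Suc n]" by (simp add: l del: upt_Suc)
  moreover have "inj_on w {1..n}" using permutes_inj[OF w] by (rule inj_on_subset) simp
  ultimately have dist: "distinct (map fst (path_entries n P))"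
    by (simp add: distinct_map atLeastLessThanSuc_atLeastAtMost del: upt_Suc)
  have "fst ` set (path_entries n P) = w ` {1..n}"
    by (simp add: l image_image atLeastLessThanSuc_atLeastAtMost del: upt_Suc)
  then have im: "fst ` set (path_entries n P) = {1..n}" using permutes_image[OF w] by simp
  \<comment> \<open>The first north step is on level 1 with a positive label, and index 1 is never a
    contractible valley.\<close>
  have "may_follow origin (?f 1)" if "1 \<le> n"
  proof -
    have "area_word \<pi> 1 = 0" using column_area[OF d, of 1] that by simp
    moreover have "w 1 \<ge> 1" using permutes_in_image[OF w, of 1] that by simp
    moreover have "1 \<notin> dv" using dv by (auto simp: contractible_valleys_def)
    ultimately show ?thesis by (simp add: may_follow_def)
  qed
  moreover have "may_follow (?f (Suc i)) (?f (Suc (Suc i)))" if i: "Suc i < n" for i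
  proof -
    have c: "column \<pi> (Suc i) + area_word \<pi> (Suc i) = i"
      "column \<pi> (Suc (Suc i)) + area_word \<pi> (Suc (Suc i)) = Suc i"
      "column \<pi> (Suc i) \<le> column \<pi> (Suc (Suc i))"
      using i column_area[OF d, of "Suc i"] column_area[OF d, of "Suc (Suc i)"]
        column_mono[OF d, of "Suc i" "Suc (Suc i)"] by simp_all
    have "w (Suc i) < w (Suc (Suc i))"
      if "area_word \<pi> (Suc (Suc i)) = Suc (area_word \<pi> (Suc i))"
    proof -
      have "column \<pi> (Suc i) = column \<pi> (Suc (Suc i))" using that c by linarith
      then show ?thesis using lab i unfolding st_labelling_def by simp
    qed
    moreover have "area_word \<pi> (Suc (Suc i)) \<le> Suc (area_word \<pi> (Suc i))" using c by linarith
    moreover have "area_word \<pi> (Suc i) > area_word \<pi> (Suc (Suc i)) \<or>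
        area_word \<pi> (Suc i) = area_word \<pi> (Suc (Suc i)) \<and> w (Suc i) < w (Suc (Suc i))"
      if "Suc (Suc i) \<in> dv"
      using that dv by (auto simp: contractible_valleys_def)
    ultimately show ?thesis unfolding may_follow_def fst_conv snd_conv by auto
  qed
  ultimately have "successively may_follow (origin # path_entries n P)"
    unfolding successively_Cons_nth len
    using nth len length_greater_0_conv[of "path_entries n P"] by (auto simp: Suc_le_eq)
  moreover have "\<forall>x\<in>set (path_entries n P). level x \<ge> 1" by (auto simp: l)
  ultimately show ?thesis using dist im by (simp add: labelled_paths_def)
qed

lemma path_entries_inject:
  assumes "P \<in> stLD n k" "P' \<in> stLD n k'" "path_entries n P = path_entries n P'"
  shows "P = P'"
proof -
  obtain \<pi> w dv \<pi>' w' dv' where P: "P = (\<pi>, w, dv)" "P' = (\<pi>', w', dv')"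
    by (cases P; cases P') auto
  have d: "dyck_path n \<pi>" "dyck_path n \<pi>'" and w: "w permutes {1..n}" "w' permutes {1..n}"
    and dv: "dv \<subseteq> {1..n}" "dv' \<subseteq> {1..n}"
    using assms(1,2) by (auto simp: P stLD_def st_labelling_def contractible_valleys_def)
  have eq: "w i = w' i \<and> area_word \<pi> i = area_word \<pi>' i \<and> (i \<in> dv \<longleftrightarrow> i \<in> dv')" if "i \<in> {1..n}" for i
  proof -
    have "i \<in> set [1..<Suc n]" using that by auto
    with assms(3) show ?thesis unfolding path_entries_def P prod.case map_eq_conv by auto
  qed
  have "w i = w' i" for i
    using eq[of i] permutes_not_in[OF w(1), of i] permutes_not_in[OF w(2), of i]
    by (cases "i \<in> {1..n}") auto
  moreover have "dv = dv'" using eq dv by blast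
  moreover have "\<pi> = \<pi>'"
  proof (rule north_columns_inject[of 0])
    show "north_columns 0 \<pi> = north_columns 0 \<pi>'"
    proof (rule nth_equalityI)
      fix i assume "i < length (north_columns 0 \<pi>)"
      then have i: "i < n" using d by (simp add: dyck_path_iff)
      have "column \<pi> (Suc i) = column \<pi>' (Suc i)"
        using column_area[OF d(1), of "Suc i"] column_area[OF d(2), of "Suc i"] eq[of "Suc i"] i
        by simp
      then show "north_columns 0 \<pi> ! i = north_columns 0 \<pi>' ! i" by (simp add: column_def)
    qed (use d in \<open>simp add: dyck_path_iff\<close>)
  qed (use d in \<open>simp add: dyck_path_iff\<close>)
  ultimately show ?thesis by (auto simp: P)
qed

lemma path_entries_surj:
  assumes l: "l \<in> labelled_paths n" and n: "n \<ge> 1"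
  shows "\<exists>k\<le>n - 1. \<exists>P\<in>stLD n k. path_entries n P = l"
proof -
  have len: "length l = n" by (rule labelled_paths_length[OF l])
  have suc: "successively may_follow (origin # l)" and im: "fst ` set l = {1..n}"
    and lev: "\<And>x. x \<in> set l \<Longrightarrow> level x \<ge> 1" and dist: "distinct (map fst l)"
    using l by (auto simp: labelled_paths_def)
  have first: "may_follow origin (l ! 0)"
    and step: "\<And>i. Suc i < n \<Longrightarrow> may_follow (l ! i) (l ! Suc i)"
    using suc n len unfolding successively_Cons_nth by auto
  define a where "a i = level (l ! i) - 1" for i
  have la: "level (l ! i) = Suc (a i)" if "i < n" for i
    using lev[of "l ! i"] that len by (simp add: a_def)
  have a_le: "a i \<le> i" if "i < n" for i
    using level_le_Suc_index[OF suc, of i] that len by (simp add: a_def)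
  have a_step: "a (Suc i) \<le> Suc (a i)" if "Suc i < n" for i
    using step[OF that] la that by (simp add: may_follow_def)
  \<comment> \<open>Counted from 0, north step \<open>i\<close> starts at height \<open>i\<close>,
    so \<open>i - a i\<close> is its column. The columns are sorted because the area rises by at
    most 1.\<close>
  define xs where "xs = map (\<lambda>i. i - a i) [0..<n]"
  have "sorted xs"
    unfolding sorted_iff_nth_Suc
  proof (intro allI impI)
    fix i assume "Suc i < length xs"
    then have "Suc i < n" by (simp add: xs_def)
    then show "xs ! i \<le> xs ! Suc i" using a_step[of i] a_le[of i] by (simp add: xs_def)
  qed
  moreover have "\<forall>x\<in>set xs. 0 \<le> x \<and> x \<le> n" by (auto simp: xs_def)
  ultimately obtain \<pi> where \<pi>: "north_columns 0 \<pi> = xs" "count_list \<pi> East = n"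
    using ex_north_columns[of xs 0 n] by auto
  have d: "dyck_path n \<pi>" unfolding dyck_path_iff \<pi> by (simp add: xs_def)
  have col: "column \<pi> (Suc i) = i - a i" and area: "area_word \<pi> (Suc i) = a i" if "i < n" for i
    using that a_le[OF that] by (simp_all add: column_def area_word_def \<pi> xs_def)
  define w where "w i = (if i \<in> {1..n} then fst (l ! (i - 1)) else i)" for i
  define dv where "dv = {i \<in> {1..n}. decorated (l ! (i - 1))}"
  have w: "w permutes {1..n}"
  proof (rule bij_imp_permutes)
    have inj: "inj_on w {1..n}"
    proof (rule inj_onI)
      fix i j assume ij: "i \<in> {1..n}" "j \<in> {1..n}" "w i = w j"
      have less: "i - 1 < length l" "j - 1 < length l" using ij len by auto
      then have "map fst l ! (i - 1) = map fst l ! (j - 1)" using ij by (simp add: w_def)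
      then have "i - 1 = j - 1" using nth_eq_iff_index_eq[OF dist] less by simp
      then show "i = j" using ij by auto
    qed
    moreover have "w ` {1..n} \<subseteq> {1..n}"
    proof
      fix x assume "x \<in> w ` {1..n}"
      then obtain i where "i \<in> {1..n}" "x = fst (l ! (i - 1))" by (auto simp: w_def)
      moreover have "l ! (i - 1) \<in> set l" using calculation len by (intro nth_mem) auto
      ultimately show "x \<in> {1..n}" using im by blast
    qed
    ultimately show "bij_betw w {1..n} {1..n}"
      unfolding bij_betw_def using endo_inj_surj[of "{1..n}" w] by blast
  qed (auto simp: w_def)
  have w_step: "w (Suc i) < w (Suc (Suc i))"
    if "Suc i < n" "column \<pi> (Suc i) = column \<pi> (Suc (Suc i))" for i
  proof -
    have "a (Suc i) = Suc (a i)"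
      using that col[of i] col[of "Suc i"] a_le[of i] a_le[of "Suc i"] by simp
    then show ?thesis using step[OF that(1)] la that(1) by (simp add: may_follow_def w_def)
  qed
  \<comment> \<open>Columns increase weakly, so all steps between \<open>i\<close> and
    \<open>j\<close> share the column and the comparison of neighbours is enough.\<close>
  have w_col: "w i < w j" if "1 \<le> i" "i < j" "j \<le> n" "column \<pi> i = column \<pi> j" for i j
    using that(2,3,4)
  proof (induction j)
    case (Suc j)
    have c: "column \<pi> i \<le> column \<pi> j" "column \<pi> j \<le> column \<pi> (Suc j)"
      using column_mono[OF d, of i j] column_mono[OF d, of j "Suc j"] Suc.prems that(1) by auto
    then have "w j < w (Suc j)"
      using w_step[of "j - 1"] Suc.prems that(1) by auto
    then show ?case using Suc c by (cases "i = j") auto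
  qed simp
  have dvs: "dv \<subseteq> contractible_valleys n \<pi> w"
  proof
    fix i assume i: "i \<in> dv"
    then have "i \<noteq> 1" using first la[of 0] n by (auto simp: dv_def may_follow_def)
    then obtain j where j: "i = Suc (Suc j)" "Suc j < n"
      using i by (cases i; cases "i - 1") (auto simp: dv_def)
    then show "i \<in> contractible_valleys n \<pi> w"
      using step[OF j(2)] la[of j] la[of "Suc j"] area[of j] area[of "Suc j"] i
      by (auto simp: contractible_valleys_def may_follow_def w_def dv_def)
  qed
  \<comment> \<open>Since index 1 is excluded, the number of decorations stays in the range
    \<open>k \<le> n - 1\<close> of the theorem.\<close>
  have "dv \<subseteq> {2..n}" using dvs by (auto simp: contractible_valleys_def)
  then have "card dv \<le> n - 1" using card_mono[of "{2..n}" dv] by simp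
  moreover have "(\<pi>, w, dv) \<in> stLD n (card dv)"
    using d w w_col dvs by (simp add: stLD_def st_labelling_def)
  moreover have "path_entries n (\<pi>, w, dv) = l"
  proof (rule nth_equalityI)
    fix i assume "i < length (path_entries n (\<pi>, w, dv))"
    then have i: "i < n" by (simp add: path_entries_def del: upt_Suc)
    then have "path_entries n (\<pi>, w, dv) ! i = (w (Suc i), Suc (area_word \<pi> (Suc i)), Suc i \<in> dv)"
      by (simp add: path_entries_def del: upt_Suc)
    also have "\<dots> = l ! i"
      using i area la by (simp add: w_def dv_def prod_eq_iff)
    finally show "path_entries n (\<pi>, w, dv) ! i = l ! i" .
  qed (simp add: path_entries_def len del: upt_Suc)
  ultimately show ?thesis by blast
qed

section \<open>Comparison of the weights\<close>

lemma inv_count_map: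
  "inv_count (map f [a..<a + m]) =
    card {(i, j). a \<le> i \<and> i < j \<and> j < a + m \<and> diag_inv (f i) (f j)}"
proof (induction m arbitrary: a)
  case 0
  have "{(i, j). a \<le> i \<and> i < j \<and> j < a + 0 \<and> diag_inv (f i) (f j)} = {}" by auto
  then show ?case by (simp only: card.empty) simp
next
  case (Suc m)
  let ?S = "\<lambda>a m. {(i, j). a \<le> i \<and> i < j \<and> j < a + m \<and> diag_inv (f i) (f j)}"
  let ?J = "{j. diag_inv (f a) (f j)} \<inter> {Suc a..<Suc a + m}"
  have "?S a (Suc m) = Pair a ` ?J \<union> ?S (Suc a) m"
  proof (rule set_eqI)
    fix x show "x \<in> ?S a (Suc m) \<longleftrightarrow> x \<in> Pair a ` ?J \<union> ?S (Suc a) m"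
      by (cases x; cases "fst x = a") (auto simp: image_iff)
  qed
  moreover have "card (Pair a ` ?J \<union> ?S (Suc a) m) = card (Pair a ` ?J) + card (?S (Suc a) m)"
  proof (rule card_Un_disjoint)
    show "finite (?S (Suc a) m)"
      by (rule finite_subset[of _ "{..Suc a + m} \<times> {..Suc a + m}"]) auto
  qed auto
  moreover have "card (Pair a ` ?J) = card ?J" by (rule card_image) (simp add: inj_on_def)
  moreover have "length (filter (diag_inv (f a)) (map f [Suc a..<Suc a + m])) = card ?J"
    by (simp add: filter_map distinct_length_filter o_def del: upt_Suc)
  moreover have "[a..<a + Suc m] = a # [Suc a..<Suc a + m]" by (simp add: upt_conv_Cons del: upt_Suc)
  ultimately show ?case using Suc.IH[of "Suc a"] by simp
qed

lemma weight_path_entries: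
  assumes "(\<pi>, w, dv) \<in> stLD n k"
  shows "path_weight t z (path_entries n (\<pi>, w, dv)) =
    (- 1) ^ (card (primary_dinv n (\<pi>, w, dv)) + card (secondary_dinv n (\<pi>, w, dv)) + k) *
      (t ^ area n (\<pi>, w, dv) * z ^ k)"
proof -
  let ?f = "\<lambda>i. (w i, Suc (area_word \<pi> i), i \<in> dv)"
  have l: "path_entries n (\<pi>, w, dv) = map ?f [1..<Suc n]" by (simp add: path_entries_def)
  have w: "w permutes {1..n}" and dv: "dv \<subseteq> {1..n}" "card dv = k"
    using assms by (auto simp: stLD_def st_labelling_def contractible_valleys_def)
  have inj: "inj_on ?f A" for A
    using permutes_inj[OF w] by (auto simp: inj_on_def)
  have set: "set (map ?f [1..<Suc n]) = ?f ` {1..n}"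
    by (simp add: atLeastLessThanSuc_atLeastAtMost del: upt_Suc)
  have "inv_count (map ?f [1..<Suc n]) =
      card {(i, j). 1 \<le> i \<and> i < j \<and> j < 1 + n \<and> diag_inv (?f i) (?f j)}"
    using inv_count_map[of ?f 1 n] by (simp del: upt_Suc)
  also have "{(i, j). 1 \<le> i \<and> i < j \<and> j < 1 + n \<and> diag_inv (?f i) (?f j)} =
      primary_dinv n (\<pi>, w, dv) \<union> secondary_dinv n (\<pi>, w, dv)"
    by (auto simp: diag_inv_def)
  also have "card \<dots> = card (primary_dinv n (\<pi>, w, dv)) + card (secondary_dinv n (\<pi>, w, dv))"
  proof (rule card_Un_disjoint)
    have "finite ({..n} \<times> {..n})" by simp
    then show "finite (primary_dinv n (\<pi>, w, dv))" "finite (secondary_dinv n (\<pi>, w, dv))"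
      by (rule rev_finite_subset; auto)+
  qed auto
  finally have inv: "inv_count (map ?f [1..<Suc n]) =
      card (primary_dinv n (\<pi>, w, dv)) + card (secondary_dinv n (\<pi>, w, dv))" .
  have "length (filter (\<lambda>x. decorated x) (map ?f [1..<Suc n])) = card ({i. i \<in> dv} \<inter> set [1..<Suc n])"
    by (simp add: filter_map distinct_length_filter o_def del: upt_Suc)
  also have "{i. i \<in> dv} \<inter> set [1..<Suc n] = dv" using dv(1) by auto
  finally have dec: "length (filter (\<lambda>x. decorated x) (map ?f [1..<Suc n])) = k" using dv(2) by simp
  have "(\<Sum>x\<in>?f ` {1..n}. level x - 1) = area n (\<pi>, w, dv)"
    by (subst sum.reindex[OF inj]) simp
  moreover have "{x \<in> ?f ` {1..n}. decorated x} = ?f ` dv" using dv(1) by auto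
  then have "card {x \<in> ?f ` {1..n}. decorated x} = k"
    by (simp only: card_image[OF inj] dv(2))
  ultimately show ?thesis
    unfolding path_weight_def path_sign_def l inv dec set by simp
qed

lemma finite_labelled_paths: "finite (labelled_paths n)"
  unfolding labelled_paths_eq_UN using finite_bounded_words finite_paths by auto

lemma finite_stLD: "finite (stLD n k)"
proof (rule finite_imageD)
  show "finite (path_entries n ` stLD n k)"
    using path_entries_labelled by (intro finite_subset[OF _ finite_labelled_paths[of n]]) auto
  show "inj_on (path_entries n) (stLD n k)" 
    by (rule inj_onI) (rule path_entries_inject)
qed

lemma stLD_sum:
  fixes t z :: "'a::comm_ring_1"
  assumes n: "n \<ge> 1"
  shows "(\<Sum>k = 0..n - 1. \<Sum>P\<in>stLD n k.
      (- 1) ^ (card (primary_dinv n P) + card (secondary_dinv n P) + k) * (t ^ area n P * z ^ k)) =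
    (\<Sum>\<sigma> | \<sigma> permutes {1..n}. t ^ inv3 n \<sigma> * z ^ monot n \<sigma>)"
proof -
  have bij: "bij_betw (\<lambda>(k, P). path_entries n P) (SIGMA k:{0..n - 1}. stLD n k) (labelled_paths n)"
  proof (intro bij_betwI')
    fix u v assume "u \<in> (SIGMA k:{0..n - 1}. stLD n k)" "v \<in> (SIGMA k:{0..n - 1}. stLD n k)"
    then obtain k P k' P' where uv: "u = (k, P)" "v = (k', P')" "P \<in> stLD n k" "P' \<in> stLD n k'"
      by auto
    have "k = k'" if "P = P'" using that uv(3,4) by (auto simp: stLD_def)
    then show "((\<lambda>(k, P). path_entries n P) u = (\<lambda>(k, P). path_entries n P) v) = (u = v)"
      using uv(1,2) path_entries_inject[OF uv(3,4)] by auto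
  next
    fix u assume "u \<in> (SIGMA k:{0..n - 1}. stLD n k)"
    then show "(\<lambda>(k, P). path_entries n P) u \<in> labelled_paths n"
      using path_entries_labelled by auto
  next
    fix l assume "l \<in> labelled_paths n"
    from path_entries_surj[OF this n]
    show "\<exists>u\<in>SIGMA k:{0..n - 1}. stLD n k. l = (\<lambda>(k, P). path_entries n P) u" by force
  qed
  have "(\<Sum>k = 0..n - 1. \<Sum>P\<in>stLD n k.
      (- 1) ^ (card (primary_dinv n P) + card (secondary_dinv n P) + k) * (t ^ area n P * z ^ k)) =
    (\<Sum>k = 0..n - 1. \<Sum>P\<in>stLD n k. path_weight t z (path_entries n P))"
  proof (intro sum.cong refl)
    fix k P assume "P \<in> stLD n k"
    then have "(fst P, fst (snd P), snd (snd P)) \<in> stLD n k" by simp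
    from weight_path_entries[OF this, of t z]
    show "(- 1) ^ (card (primary_dinv n P) + card (secondary_dinv n P) + k) *
        (t ^ area n P * z ^ k) = path_weight t z (path_entries n P)"
      by simp
  qed
  also have "\<dots> = (\<Sum>(k, P)\<in>(SIGMA k:{0..n - 1}. stLD n k). path_weight t z (path_entries n P))"
    by (rule sum.Sigma) (use finite_stLD in auto)
  also have "\<dots> = sum (path_weight t z) (labelled_paths n)"
    using sum.reindex_bij_betw[OF bij, of "path_weight t z"] by (simp add: case_prod_unfold)
  finally show ?thesis
    unfolding labelled_paths_sum odd_words_permutations[OF n] .
qed


section \<open>Specialisation at \<open>q = -1\<close>\<close>

text \<open>The relation whose functionality makes the \<open>THE\<close> in \<^const>\<open>q_at\<close> well defined.\<close>

definition q_value :: "rat \<Rightarrow> rat_qt \<Rightarrow> rat_t \<Rightarrow> bool" where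
  "q_value c f v \<longleftrightarrow> (\<exists>a b. poly b [:c:] \<noteq> 0 \<and> f = Fract a b \<and>
    v = Fract (poly a [:c:]) (poly b [:c:]))"

lemma q_value_unique:
  assumes "q_value c f v" "q_value c f v'"
  shows "v = v'"
proof -
  obtain a b where *: "poly b [:c:] \<noteq> 0" "f = Fract a b" "v = Fract (poly a [:c:]) (poly b [:c:])"
    using assms(1) unfolding q_value_def by blast
  obtain a' b' where **: "poly b' [:c:] \<noteq> 0" "f = Fract a' b'"
    "v' = Fract (poly a' [:c:]) (poly b' [:c:])"
    using assms(2) unfolding q_value_def by blast
  have "b \<noteq> 0" "b' \<noteq> 0" using *(1) **(1) by auto
  moreover have "Fract a b = Fract a' b'" using *(2) **(2) by simp
  ultimately have "a * b' = a' * b" using eq_fract(1)[of b b' a a'] by simp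
  then have "poly a [:c:] * poly b' [:c:] = poly a' [:c:] * poly b [:c:]"
    by (metis poly_mult)
  then show ?thesis using *(1,3) **(1,3) by (simp add: eq_fract)
qed

lemma q_at_eq: "q_value c f v \<Longrightarrow> q_at c f = v"
  unfolding q_at_def q_value_def[symmetric] by (rule the_equality) (auto dest: q_value_unique)

lemma q_value_Fract: "q_value c (Fract a 1) (Fract (poly a [:c:]) 1)"
  unfolding q_value_def by (intro exI[of _ a] exI[of _ 1]) simp

lemma q_value_add: "q_value c f v \<Longrightarrow> q_value c g u \<Longrightarrow> q_value c (f + g) (v + u)"
  unfolding q_value_def
proof (elim exE conjE)
  fix a b a' b' assume *: "poly b [:c:] \<noteq> 0" "f = Fract a b" "v = Fract (poly a [:c:]) (poly b [:c:])"
    "poly b' [:c:] \<noteq> 0" "g = Fract a' b'" "u = Fract (poly a' [:c:]) (poly b' [:c:])"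
  then have "b \<noteq> 0" "b' \<noteq> 0" by auto
  with * show "\<exists>a b. poly b [:c:] \<noteq> 0 \<and> f + g = Fract a b \<and>
      v + u = Fract (poly a [:c:]) (poly b [:c:])"
    by (intro exI[of _ "a * b' + a' * b"] exI[of _ "b * b'"]) simp
qed

lemma q_value_mult: "q_value c f v \<Longrightarrow> q_value c g u \<Longrightarrow> q_value c (f * g) (v * u)"
  unfolding q_value_def
proof (elim exE conjE)
  fix a b a' b' assume "poly b [:c:] \<noteq> 0" "f = Fract a b" "v = Fract (poly a [:c:]) (poly b [:c:])"
    "poly b' [:c:] \<noteq> 0" "g = Fract a' b'" "u = Fract (poly a' [:c:]) (poly b' [:c:])"
  then show "\<exists>a b. poly b [:c:] \<noteq> 0 \<and> f * g = Fract a b \<and>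
      v * u = Fract (poly a [:c:]) (poly b [:c:])"
    by (intro exI[of _ "a * a'"] exI[of _ "b * b'"]) simp
qed

lemma q_value_inverse: "q_value c f v \<Longrightarrow> v \<noteq> 0 \<Longrightarrow> q_value c (inverse f) (inverse v)"
  unfolding q_value_def
proof (elim exE conjE)
  fix a b assume *: "v \<noteq> 0" "poly b [:c:] \<noteq> 0" "f = Fract a b"
    "v = Fract (poly a [:c:]) (poly b [:c:])"
  then have "poly a [:c:] \<noteq> 0" by (auto simp: fract_collapse)
  with * show "\<exists>a b. poly b [:c:] \<noteq> 0 \<and> inverse f = Fract a b \<and>
      inverse v = Fract (poly a [:c:]) (poly b [:c:])"
    by (intro exI[of _ b] exI[of _ a]) simp
qed

lemma q_value_0: "q_value c 0 0" and q_value_1: "q_value c 1 1"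
  using q_value_Fract[of c 0] q_value_Fract[of c 1] by (simp_all add: fract_collapse)

lemma q_value_power: "q_value c f v \<Longrightarrow> q_value c (f ^ m) (v ^ m)"
  by (induction m) (simp_all add: q_value_1 q_value_mult)

text \<open>\<open>dinv\<close> is an integer by definition, so negative powers of \<open>q\<close>
  have to be specialised as well; the value \<open>-1\<close> is invertible.\<close>

lemma q_value_power_int: "q_value c f v \<Longrightarrow> v \<noteq> 0 \<Longrightarrow> q_value c (f powi m) (v powi m)"
  unfolding power_int_def by (auto intro!: q_value_power q_value_inverse)

lemma q_value_sum:
  "(\<And>x. x \<in> A \<Longrightarrow> q_value c (f x) (v x)) \<Longrightarrow> q_value c (sum f A) (sum v A)"
  by (induction A rule: infinite_finite_induct) (simp_all add: q_value_0 q_value_add)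

lemma q_value_vars: "q_value c q_var (Fract [:c:] 1)" "q_value c t_var (Fract [:0, 1:] 1)"
  using q_value_Fract[of c "[:0, 1:]"] q_value_Fract[of c "[:[:0, 1:]:]"]
  by (simp_all add: q_var_def t_var_def)

lemma minus_one_power_int_diff:
  "(- 1 :: 'a::field) powi (int a + int b - int c) = (- 1) ^ (a + b + c)"
proof -
  have "(- 1 :: 'a) powi (int a + int b - int c) = (- 1) ^ (a + b) / (- 1) ^ c"
    by (simp add: power_int_diff power_int_add power_add)
  also have "\<dots> = (- 1) ^ (a + b) * (- 1) ^ c"
    by (cases "even c") auto
  finally show ?thesis by (simp add: power_add)
qed

lemma q_at_stLD:
  "q_at (- 1) (\<Sum>P\<in>stLD n k. q_var powi dinv n P * t_var ^ area n P) =
    (\<Sum>P\<in>stLD n k. (- 1) ^ (card (primary_dinv n P) + card (secondary_dinv n P) + k) *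
      Fract [:0, 1:] 1 ^ area n P)"
proof (intro q_at_eq q_value_sum q_value_mult q_value_power q_value_vars)
  fix P assume P: "P \<in> stLD n k"
  have "Fract [:- 1:] 1 = (- 1 :: rat_t)"
    by (metis minus_fract One_fract_def minus_pCons minus_zero one_pCons pCons_0_0)
  then have "q_value (- 1) q_var (- 1)" using q_value_vars(1)[of "- 1"] by simp
  then have "q_value (- 1) (q_var powi dinv n P) ((- 1) powi dinv n P)"
    by (rule q_value_power_int) simp
  moreover have "card (snd (snd P)) = k" using P by (auto simp: stLD_def)
  ultimately show "q_value (- 1) (q_var powi dinv n P)
      ((- 1) ^ (card (primary_dinv n P) + card (secondary_dinv n P) + k))"
    by (simp only: dinv_def minus_one_power_int_diff)
qed

lemma monom_const_power:
  "monom ((- 1) ^ e * t ^ a) k = (- 1) ^ e * ([:t:] ^ a * monom 1 1 ^ k :: 'a::comm_ring_1 poly)"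
proof -
  have "[:t:] ^ a = [:t ^ a:]" by (induction a) (simp_all add: one_pCons)
  moreover have "monom (1::'a) 1 ^ k = monom 1 k" by (simp add: monom_power)
  moreover have "(- 1 :: 'a poly) ^ e = [:(- 1) ^ e:]" by (induction e) (simp_all add: one_pCons)
  ultimately show ?thesis by (simp add: smult_monom)
qed

theorem corollary1p2:
  assumes "\<And>n k :: nat. 1 \<le> n \<Longrightarrow> k \<le> n - 1 \<Longrightarrow>
    hall (Delta' (elementary (n - k - 1)) (elementary n)) (homogeneous 1 ^ n) =
      (\<Sum>P\<in>stLD n k. q_var powi dinv n P * t_var ^ area n P)"
  shows "\<forall>n\<ge>1.
    (\<Sum>k = 0..n - 1. monom
      (q_at (- 1) (hall (Delta' (elementary (n - k - 1)) (elementary n)) (homogeneous 1 ^ n))) k) =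
    (\<Sum>\<sigma> | \<sigma> permutes {1..n}. monom (Fract [:0, 1:] 1 ^ inv3 n \<sigma> :: rat_t) (monot n \<sigma>))"
proof (intro allI impI)
  fix n :: nat assume n: "n \<ge> 1"
  let ?t = "Fract [:0, 1:] 1 :: rat_t"
  have "(\<Sum>k = 0..n - 1. monom
      (q_at (- 1) (hall (Delta' (elementary (n - k - 1)) (elementary n)) (homogeneous 1 ^ n))) k) =
    (\<Sum>k = 0..n - 1. \<Sum>P\<in>stLD n k.
      (- 1) ^ (card (primary_dinv n P) + card (secondary_dinv n P) + k) *
        ([:?t:] ^ area n P * monom 1 1 ^ k))"
    by (intro sum.cong refl)
      (simp only: assms[OF n] atLeastAtMost_iff q_at_stLD monom_sum monom_const_power)
  \<comment> \<open>The identity is applied in the ring \<open>rat_t poly\<close>, with the constant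
    polynomial \<open>[:?t:]\<close> for \<open>t\<close> and the polynomial variable
    \<open>monom 1 1\<close> for \<open>z\<close>.\<close>
  also have "\<dots> = (\<Sum>\<sigma> | \<sigma> permutes {1..n}. [:?t:] ^ inv3 n \<sigma> * monom 1 1 ^ monot n \<sigma>)"
    by (rule stLD_sum[OF n])
  also have "\<dots> = (\<Sum>\<sigma> | \<sigma> permutes {1..n}. monom (?t ^ inv3 n \<sigma>) (monot n \<sigma>))"
    using monom_const_power[of 0 ?t] by (intro sum.cong refl) simp
  finally show "(\<Sum>k = 0..n - 1. monom
      (q_at (- 1) (hall (Delta' (elementary (n - k - 1)) (elementary n)) (homogeneous 1 ^ n))) k) =
    (\<Sum>\<sigma> | \<sigma> permutes {1..n}. monom (?t ^ inv3 n \<sigma>) (monot n \<sigma>))" .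
qed

end
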